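(* Assume $\dim\mathfrak X<\infty$ and let $\{V_n:n\in\mathbb N\}$ be a sequence of uncorrelated and compactly uniformly integrable (in $L^1$) $\mathcal P_{kc}(\mathfrak X)$-valued random variables. Suppose that for every $x^*\in S^*$, $$\sum_{n=1}^\infty\frac{\mathrm{Var}(\sigma(x^*,V_n))}{n^2}\log^2 n<\infty.$$ Then $$d_H\Big(\frac1n\sum_{k=1}^n V_k,\ \frac1n\sum_{k=1}^n E[V_k]\Big)\longrightarrow 0\quad\text{as } n\to\infty,\ \text{a.s.}$$
   Context: $(\Omega,\mathcal A,\mu)$ is a complete, non-atomic probability space; $E$, $\mathrm{Var}$, $\mathrm{cov}$ and "a.s." are with respect to $\mu$. $(\mathfrak X,\|\cdot\|)$ is a real separable Banach space with dual $(\mathfrak X^*,\|\cdot\|_{\mathfrak X^*})$, and $S^*$ is the unit sphere of $\mathfrak X^*$. $\mathcal P_k(\mathfrak X)$ (resp. $\mathcal P_{kc}(\mathfrak X)$) is the family of nonempty compact (resp. compact convex) subsets of $\mathfrak X$. $A+B=\{a+b:a\in A,b\in B\}$, $\lambda A=\{\lambda a:a\in A\}$; sums of sets are Minkowski sums. The Hausdorff metric is $d_H(A,B)=\max\{\sup_{a\in A}\inf_{b\in B}\|a-b\|,\ \sup_{b\in B}\inf_{a\in A}\|a-b\|\}$, and $\|A\|_{\mathcal P}=d_H(\{0\},A)=\sup_{a\in A}\|a\|$. The support function is $\sigma(x^*,A)=\sup_{a\in A}\langle x^*,a\rangle$, $x^*\in\mathfrak X^*$. A set-valued random variable is a map $F$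 from $\Omega$ to the nonempty closed subsets of $\mathfrak X$ with $\{\omega:F(\omega)\cap O\neq\emptyset\}\in\mathcal A$ for every open $O\subset\mathfrak X$; it is $\mathcal P_{kc}(\mathfrak X)$-valued if all its values lie in $\mathcal P_{kc}(\mathfrak X)$. Its expectation is the Aumann integral $E[F]=\{E[f]:f\in S_F\}$, where $S_F$ is the set of Bochner integrable $f:\Omega\to\mathfrak X$ with $f(\omega)\in F(\omega)$ a.s. Real random variables $\xi,\eta$ are uncorrelated if $\mathrm{cov}(\xi,\eta)=0$. A sequence of set-valued random variables $\{F_1,F_2,\dots\}$ is (pairwise) uncorrelated if for every $x^*\in\mathfrak X^*$ the real random variables $\sigma(x^*,F_1),\sigma(x^*,F_2),\dots$ are pairwise uncorrelated. A sequence $\{F_n\}$ of $\mathcal P_k(\mathfrak X)$-valued random variables is compactly uniformly integrable in $L^p$ ($p\ge1$) if for each $\epsilon>0$ there is a compact subset $\mathcal K_\epsilon$ of the metric space $(\mathcal P_k(\mathfrak X),d_H)$ such that $E\big[\|F_n\|_{\mathcal P}^p\, I_{\{F_n\notin\mathcal K_\epsilon\}}\big]<\epsilon$ for all $n$, where $I$ is the indicator function. *)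

theory Defs
  imports "HOL-Probability.Probability"
begin

text \<open>Convention: a sequence $F_1, F_2, \dots$ is a function on \<^typ>\<open>nat\<close> of which
  only the values at indices $\ge 1$ matter.\<close>

definition nonatomic :: "'w measure \<Rightarrow> bool" where
  "nonatomic M \<longleftrightarrow>
     (\<forall>A\<in>sets M. emeasure M A > 0 \<longrightarrow>
        (\<exists>B\<in>sets M. B \<subseteq> A \<and> 0 < emeasure M B \<and> emeasure M B < emeasure M A))"

section \<open>Compact sets and the Hausdorff metric\<close>

definition Pk :: "'a::real_normed_vector set set" where
  "Pk = {A. A \<noteq> {} \<and> compact A}"

definition Pkc :: "'a::real_normed_vector set set" where
  "Pkc = {A. A \<noteq> {} \<and> compact A \<and> convex A}"

text \<open>The suprema are taken in the reals, so the value is meaningful for nonempty bounded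
  sets only.\<close>
definition hausdorff_dist :: "'a::real_normed_vector set \<Rightarrow> 'a set \<Rightarrow> real" where
  "hausdorff_dist A B =
     max (SUP a\<in>A. INF b\<in>B. norm (a - b)) (SUP b\<in>B. INF a\<in>A. norm (a - b))"

definition set_norm :: "'a::real_normed_vector set \<Rightarrow> real" where
  "set_norm A = hausdorff_dist {0} A"

text \<open>The locale \<^locale>\<open>Metric_space\<close> wants a distance that is nonnegative also outside the
  carrier; hence the cut-off. The topology depends only on the values on the carrier.\<close>
definition Pk_dist :: "'a::real_normed_vector set \<Rightarrow> 'a set \<Rightarrow> real" where
  "Pk_dist A B = (if A \<in> Pk \<and> B \<in> Pk then hausdorff_dist A B else 0)"

lemma Pk_iff: "A \<in> Pk \<longleftrightarrow> A \<noteq> {} \<and> compact A"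
  by (simp add: Pk_def)

lemma hausdorff_dist_infdist:
  assumes "A \<noteq> {}" "B \<noteq> {}"
  shows "hausdorff_dist A B = max (SUP a\<in>A. infdist a B) (SUP b\<in>B. infdist b A)"
  using assms by (simp add: hausdorff_dist_def infdist_notempty dist_norm norm_minus_commute)

lemma bdd_above_infdist:
  fixes A B :: "'a::real_normed_vector set"
  assumes "bounded A"
  shows "bdd_above ((\<lambda>a. infdist a B) ` A)"
proof -
  obtain e where "\<And>a. a \<in> A \<Longrightarrow> dist 0 a \<le> e"
    using assms bounded_any_center[of A 0] by auto
  then have "infdist a B \<le> infdist 0 B + e" if "a \<in> A" for a
    using infdist_triangle[of a B 0] that by (metis add_left_mono dist_commute order_trans)
  then show ?thesis by (meson bdd_aboveI2)
qed

lemma hausdorff_dist_le_iff: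
  assumes "A \<in> Pk" "B \<in> Pk"
  shows "hausdorff_dist A B \<le> r \<longleftrightarrow>
    (\<forall>a\<in>A. infdist a B \<le> r) \<and> (\<forall>b\<in>B. infdist b A \<le> r)"
  using assms
  by (simp add: Pk_iff hausdorff_dist_infdist cSUP_le_iff bdd_above_infdist compact_imp_bounded)

lemma hausdorff_dist_commute:
  assumes "A \<in> Pk" "B \<in> Pk"
  shows "hausdorff_dist A B = hausdorff_dist B A"
  using assms by (simp add: Pk_iff hausdorff_dist_infdist max.commute)

lemma infdist_le_hausdorff_dist:
  assumes "A \<in> Pk" "B \<in> Pk" "a \<in> A"
  shows "infdist a B \<le> hausdorff_dist A B"
  using assms hausdorff_dist_le_iff[of A B "hausdorff_dist A B"] by simp

lemma hausdorff_dist_nonneg: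
  assumes "A \<in> Pk" "B \<in> Pk"
  shows "0 \<le> hausdorff_dist A B"
proof -
  obtain a where "a \<in> A" using assms by (auto simp: Pk_iff)
  from infdist_le_hausdorff_dist[OF assms this] show ?thesis
    using infdist_nonneg[of a B] by linarith
qed

lemma infdist_hausdorff_triangle:
  assumes "B \<in> Pk" "C \<in> Pk"
  shows "infdist a C \<le> infdist a B + hausdorff_dist B C"
proof -
  have "closed B" "B \<noteq> {}" using assms(1) by (auto simp: Pk_iff compact_imp_closed)
  obtain b where b: "b \<in> B" "infdist a B = dist a b"
  proof -
    have "continuous_on B (\<lambda>b. dist a b)" by (intro continuous_intros)
    then obtain b where "b \<in> B" "\<forall>y\<in>B. dist a b \<le> dist a y"
      using continuous_attains_inf[of B "\<lambda>b. dist a b"] assms(1) by (auto simp: Pk_iff)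
    moreover have "infdist a B = dist a b"
      using calculation \<open>B \<noteq> {}\<close>
      by (intro antisym infdist_le) (auto simp: infdist_notempty intro: cINF_greatest)
    ultimately show thesis using that by blast
  qed
  have "infdist a C \<le> infdist b C + dist a b" by (rule infdist_triangle)
  with b infdist_le_hausdorff_dist[OF assms b(1)] show ?thesis by simp
qed

lemma hausdorff_dist_triangle:
  assumes "A \<in> Pk" "B \<in> Pk" "C \<in> Pk"
  shows "hausdorff_dist A C \<le> hausdorff_dist A B + hausdorff_dist B C"
  unfolding hausdorff_dist_le_iff[OF assms(1,3)]
proof (intro conjI ballI)
  fix a assume "a \<in> A"
  then show "infdist a C \<le> hausdorff_dist A B + hausdorff_dist B C"
    using infdist_hausdorff_triangle[OF assms(2,3), of a]
      infdist_le_hausdorff_dist[OF assms(1,2), of a] by linarith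
next
  fix c assume "c \<in> C"
  then show "infdist c A \<le> hausdorff_dist A B + hausdorff_dist B C"
    using infdist_hausdorff_triangle[OF assms(2,1), of c]
      infdist_le_hausdorff_dist[OF assms(3,2), of c]
      hausdorff_dist_commute[OF assms(1,2)] hausdorff_dist_commute[OF assms(2,3)]
    by linarith
qed

lemma hausdorff_dist_eq_0_iff:
  assumes "A \<in> Pk" "B \<in> Pk"
  shows "hausdorff_dist A B = 0 \<longleftrightarrow> A = B"
proof
  assume "hausdorff_dist A B = 0"
  then have "\<forall>a\<in>A. infdist a B = 0" "\<forall>b\<in>B. infdist b A = 0"
    using hausdorff_dist_le_iff[OF assms, of 0] by (auto intro: antisym simp: infdist_nonneg)
  then show "A = B"
    using assms in_closed_iff_infdist_zero[of A] in_closed_iff_infdist_zero[of B]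
    by (auto simp: Pk_iff compact_imp_closed)
next
  assume "A = B"
  then show "hausdorff_dist A B = 0"
    using hausdorff_dist_le_iff[OF assms, of 0] hausdorff_dist_nonneg[OF assms] by simp
qed

lemma Metric_space_Pk: "Metric_space Pk Pk_dist"
  by unfold_locales
    (auto simp: Pk_dist_def hausdorff_dist_nonneg hausdorff_dist_commute
      hausdorff_dist_eq_0_iff hausdorff_dist_triangle)

lemma set_norm_eq_Sup_norm:
  assumes "A \<in> Pk"
  shows "set_norm A = (SUP a\<in>A. norm a)"
proof -
  have A: "A \<noteq> {}" "bounded A" using assms by (auto simp: Pk_iff compact_imp_bounded)
  obtain a where a: "a \<in> A" using A by auto
  have bdd: "bdd_above (norm ` A)" using A(2) by (simp add: bdd_above_norm)
  have "infdist 0 A \<le> norm a" using infdist_le[OF a, of 0] by simp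
  also have "\<dots> \<le> (SUP a\<in>A. norm a)" using a bdd by (rule cSUP_upper)
  finally show ?thesis
    using A unfolding set_norm_def by (simp add: hausdorff_dist_infdist max_def)
qed

section \<open>Set-valued random variables\<close>

definition set_valued_rv :: "'w measure \<Rightarrow> ('w \<Rightarrow> 'a::topological_space set) \<Rightarrow> bool" where
  "set_valued_rv M F \<longleftrightarrow>
     (\<forall>\<omega>\<in>space M. F \<omega> \<noteq> {} \<and> closed (F \<omega>)) \<and>
     (\<forall>U. open U \<longrightarrow> {\<omega>\<in>space M. F \<omega> \<inter> U \<noteq> {}} \<in> sets M)"

definition integrable_selections ::
    "'w measure \<Rightarrow> ('w \<Rightarrow> 'a::{banach, second_countable_topology} set) \<Rightarrow> ('w \<Rightarrow> 'a) set" where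
  "integrable_selections M F = {f. integrable M f \<and> (AE \<omega> in M. f \<omega> \<in> F \<omega>)}"

definition aumann_integral ::
    "'w measure \<Rightarrow> ('w \<Rightarrow> 'a::{banach, second_countable_topology} set) \<Rightarrow> 'a set" where
  "aumann_integral M F = {integral\<^sup>L M f | f. f \<in> integrable_selections M F}"

definition support_fun :: "('a::real_normed_vector \<Rightarrow>\<^sub>L real) \<Rightarrow> 'a set \<Rightarrow> real" where
  "support_fun x A = (SUP a\<in>A. blinfun_apply x a)"

definition covariance :: "'w measure \<Rightarrow> ('w \<Rightarrow> real) \<Rightarrow> ('w \<Rightarrow> real) \<Rightarrow> real" where
  "covariance M X Y =
     (\<integral>\<omega>. (X \<omega> - integral\<^sup>L M X) * (Y \<omega> - integral\<^sup>L M Y) \<partial>M)"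

text \<open>The integrability conditions say that the covariance exists; without them it would be \<open>0\<close>
  by convention.\<close>
definition uncorrelated :: "'w measure \<Rightarrow> ('w \<Rightarrow> real) \<Rightarrow> ('w \<Rightarrow> real) \<Rightarrow> bool" where
  "uncorrelated M X Y \<longleftrightarrow>
     integrable M X \<and> integrable M Y \<and> integrable M (\<lambda>\<omega>. X \<omega> * Y \<omega>) \<and> covariance M X Y = 0"

definition set_uncorrelated ::
    "'w measure \<Rightarrow> (nat \<Rightarrow> 'w \<Rightarrow> 'a::real_normed_vector set) \<Rightarrow> bool" where
  "set_uncorrelated M F \<longleftrightarrow>
     (\<forall>x :: 'a \<Rightarrow>\<^sub>L real. \<forall>m\<ge>1. \<forall>n\<ge>1. m \<noteq> n \<longrightarrow>
        uncorrelated M (\<lambda>\<omega>. support_fun x (F m \<omega>)) (\<lambda>\<omega>. support_fun x (F n \<omega>)))"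

text \<open>The variance of an integrable random variable as an extended real, which is infinite rather
  than \<open>0\<close> if there is no finite second moment.\<close>
definition nn_variance :: "'w measure \<Rightarrow> ('w \<Rightarrow> real) \<Rightarrow> ennreal" where
  "nn_variance M X = (\<integral>\<^sup>+\<omega>. ennreal ((X \<omega> - integral\<^sup>L M X)\<^sup>2) \<partial>M)"

lemma (in prob_space) nn_variance_eq_variance:
  assumes X: "integrable M X"
  shows "nn_variance M X = (if integrable M (\<lambda>\<omega>. (X \<omega>)\<^sup>2) then ennreal (variance X) else \<infinity>)"
proof -
  let ?c = "expectation X"
  have eq1: "(X \<omega> - ?c)\<^sup>2 = (X \<omega>)\<^sup>2 - 2 * ?c * X \<omega> + ?c\<^sup>2" for \<omega>
    by (simp add: power2_eq_square algebra_simps)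
  have eq2: "(X \<omega>)\<^sup>2 = (X \<omega> - ?c)\<^sup>2 + 2 * ?c * X \<omega> - ?c\<^sup>2" for \<omega>
    by (simp add: power2_eq_square algebra_simps)
  have sq: "integrable M (\<lambda>\<omega>. (X \<omega> - ?c)\<^sup>2) \<longleftrightarrow> integrable M (\<lambda>\<omega>. (X \<omega>)\<^sup>2)"
  proof
    assume "integrable M (\<lambda>\<omega>. (X \<omega> - ?c)\<^sup>2)"
    with X have "integrable M (\<lambda>\<omega>. (X \<omega> - ?c)\<^sup>2 + 2 * ?c * X \<omega> - ?c\<^sup>2)"
      by simp
    then show "integrable M (\<lambda>\<omega>. (X \<omega>)\<^sup>2)"
      unfolding eq2[symmetric] .
  next
    assume "integrable M (\<lambda>\<omega>. (X \<omega>)\<^sup>2)"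
    with X have "integrable M (\<lambda>\<omega>. (X \<omega>)\<^sup>2 - 2 * ?c * X \<omega> + ?c\<^sup>2)"
      by simp
    then show "integrable M (\<lambda>\<omega>. (X \<omega> - ?c)\<^sup>2)"
      unfolding eq1[symmetric] .
  qed
  show ?thesis
  proof (cases "integrable M (\<lambda>\<omega>. (X \<omega>)\<^sup>2)")
    case True
    then show ?thesis
      using sq by (simp add: nn_variance_def nn_integral_eq_integral)
  next
    case False
    have m: "(\<lambda>\<omega>. (X \<omega> - ?c)\<^sup>2) \<in> borel_measurable M" using X by measurable
    have "nn_variance M X = \<infinity>"
    proof (rule ccontr)
      assume "nn_variance M X \<noteq> \<infinity>"
      then have "(\<integral>\<^sup>+\<omega>. ennreal ((X \<omega> - ?c)\<^sup>2) \<partial>M) < \<infinity>"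
        unfolding nn_variance_def infinity_ennreal_def by (simp only: less_top)
      with m have "integrable M (\<lambda>\<omega>. (X \<omega> - ?c)\<^sup>2)"
        by (intro integrableI_nonneg AE_I2 zero_le_power2)
      with False sq show False by blast
    qed
    then show ?thesis using False by (simp only: if_False)
  qed
qed

text \<open>The expectation is a nonnegative Lebesgue integral, so that smallness of its value includes
  finiteness.\<close>
definition compactly_uniformly_integrable ::
    "real \<Rightarrow> 'w measure \<Rightarrow> (nat \<Rightarrow> 'w \<Rightarrow> 'a::real_normed_vector set) \<Rightarrow> bool" where
  "compactly_uniformly_integrable p M F \<longleftrightarrow>
     (\<forall>\<epsilon>>0. \<exists>K. compactin (Metric_space.mtopology Pk Pk_dist) K \<and>
        (\<forall>n\<ge>1. (\<integral>\<^sup>+\<omega>. ennreal (set_norm (F n \<omega>) powr p) * indicator {\<omega>. F n \<omega> \<notin> K} \<omega> \<partial>M)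
                 < ennreal \<epsilon>))"

end

theory Submission
  imports Defs
begin

text \<open>For a fixed functional, the support functions form an uncorrelated real sequence. Their strong
  law is proved on dyadic blocks: the Rademacher--Menshov inequality bounds the maximal partial sum in
  a block of length \<open>2 ^ j\<close> at the price of a factor \<open>(j + 1)\<^sup>2\<close>, which the logarithmic weight pays for.
  The support function of the Aumann integral is the expectation of the support function, because a
  maximising selection is obtained by passing successively to the argmax sets of the functional and
  of the coordinates. By Hahn--Banach, the Hausdorff distance of bounded convex sets is controlled by
  the difference of the support functions on the dual unit ball. Uniformity there follows from finite
  nets, since convergence at the coordinate functionals already bounds the Minkowski averages;
  uniform integrability bounds the averages of the expectations.\<close>

section \<open>The Rademacher--Menshov strong law\<close>

text \<open>Centred uncorrelated variables are orthogonal and nothing more, so Kolmogorov's maximal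
  inequality is out of reach; the squared logarithm is the price. An initial segment of a block of
  length 2^j splits into at most j + 1 dyadic pieces of different levels: Cauchy--Schwarz costs one
  factor j + 1, and adding the second moments over all j + 1 levels costs the other. The scalar law
  leaves a null set that depends on the functional, while the dual ball is uncountable. Nets of mesh
  1/(m + 1) for all m, together with the signed coordinate functionals, form one countable set; off
  its common null set the argument is deterministic. The Aumann integral is given by selections, so
  a selection attaining the maximum must be measurable. Finitely many coordinates separate points,
  hence the iterated argmax sets shrink to a single point, and for singletons measurability of the
  set is measurability of the point.\<close>

text \<open>The Rademacher--Menshov majorant: the squared sums over the dyadic subblocks of every
  level at once. One such quantity dominates all initial segments of the block.\<close>

fun dyadic_sq :: "(nat \<Rightarrow> real) \<Rightarrow> nat \<Rightarrow> nat \<Rightarrow> real" where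
  "dyadic_sq x 0 a = (x a)\<^sup>2"
| "dyadic_sq x (Suc m) a =
     (\<Sum>k\<in>{a..<a + 2 ^ Suc m}. x k)\<^sup>2 + dyadic_sq x m a + dyadic_sq x m (a + 2 ^ m)"

lemma dyadic_sq_nonneg: "0 \<le> dyadic_sq x m a"
  by (induction m arbitrary: a) auto

lemma block_sum_sq_le_dyadic_sq: "(\<Sum>k\<in>{a..<a + 2 ^ m}. x k)\<^sup>2 \<le> dyadic_sq x m a"
  by (cases m) (auto simp: dyadic_sq_nonneg)

text \<open>The binary expansion of \<open>n\<close> cuts the segment into at most m + 1 dyadic
  subblocks, and Cauchy--Schwarz gives the factor. The induction peels off one subblock at a time:
  the full left half, if \<open>n\<close> exceeds it.\<close>

lemma partial_sum_sq_le_dyadic_sq: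
  assumes "n \<le> 2 ^ m"
  shows "(\<Sum>k\<in>{a..<a + n}. x k)\<^sup>2 \<le> (real m + 1) * dyadic_sq x m a"
  using assms
proof (induction m arbitrary: a n)
  case 0
  then have "n = 0 \<or> n = 1" by auto
  then show ?case by auto
next
  case (Suc m)
  let ?Q = "dyadic_sq x m a" and ?Q' = "dyadic_sq x m (a + 2 ^ m)"
  have Q: "?Q + ?Q' \<le> dyadic_sq x (Suc m) a" by simp
  have nn: "0 \<le> ?Q" "0 \<le> ?Q'" by (rule dyadic_sq_nonneg)+
  have "(\<Sum>k\<in>{a..<a + n}. x k)\<^sup>2 \<le> (real m + 2) * (?Q + ?Q')"
  proof (cases "n \<le> 2 ^ m")
    case True
    have "(real m + 1) * ?Q \<le> (real m + 2) * (?Q + ?Q')"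
      using nn by (intro mult_mono) auto
    with Suc.IH[OF True, of a] show ?thesis by linarith
  next
    case False
    define p where "p = (\<Sum>k\<in>{a..<a + 2 ^ m}. x k)"
    define q where "q = (\<Sum>k\<in>{a + 2 ^ m..<a + 2 ^ m + (n - 2 ^ m)}. x k)"
    have "{a..<a + n} = {a..<a + 2 ^ m} \<union> {a + 2 ^ m..<a + 2 ^ m + (n - 2 ^ m)}"
      using False by auto
    then have eq: "(\<Sum>k\<in>{a..<a + n}. x k) = p + q"
      unfolding p_def q_def by (simp add: sum.union_disjoint)
    have p: "p\<^sup>2 \<le> ?Q" unfolding p_def by (rule block_sum_sq_le_dyadic_sq)
    have q: "q\<^sup>2 \<le> (real m + 1) * ?Q'"
      unfolding q_def by (rule Suc.IH) (use Suc.prems in auto)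
    \<comment> \<open>Weighted form of (p + q)^2 \<le> (1 + s) p^2 + (1 + 1/s) q^2. The choice s = m
      + 1 balances it: after the bound on \<open>q\<close>, both halves carry the factor m +
      2.\<close>
    have "0 \<le> ((real m + 1) * p - q)\<^sup>2 / (real m + 1)" by simp
    also have "\<dots> = (real m + 2) * p\<^sup>2 + (1 + 1 / (real m + 1)) * q\<^sup>2 - (p + q)\<^sup>2"
      by (simp add: field_simps power2_eq_square)
    finally have "(p + q)\<^sup>2 \<le> (real m + 2) * p\<^sup>2 + (1 + 1 / (real m + 1)) * q\<^sup>2" by simp
    also have "\<dots> \<le> (real m + 2) * ?Q + (1 + 1 / (real m + 1)) * ((real m + 1) * ?Q')"
      using p q by (intro add_mono mult_left_mono) auto
    also have "\<dots> = (real m + 2) * (?Q + ?Q')"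
      by (simp add: field_simps)
    finally show ?thesis unfolding eq .
  qed
  also have "\<dots> \<le> (real m + 2) * dyadic_sq x (Suc m) a"
    using Q by (intro mult_left_mono) auto
  finally show ?case by (simp add: algebra_simps)
qed

section \<open>Second moments under orthogonality\<close>

lemma integrable_mult_of_squares:
  fixes X Y :: "'w \<Rightarrow> real"
  assumes [measurable]: "X \<in> borel_measurable M" "Y \<in> borel_measurable M"
    and "integrable M (\<lambda>\<omega>. (X \<omega>)\<^sup>2)" "integrable M (\<lambda>\<omega>. (Y \<omega>)\<^sup>2)"
  shows "integrable M (\<lambda>\<omega>. X \<omega> * Y \<omega>)"
proof (rule Bochner_Integration.integrable_bound)
  show "integrable M (\<lambda>\<omega>. (X \<omega>)\<^sup>2 + (Y \<omega>)\<^sup>2)" using assms by simp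
  have "\<bar>x * y\<bar> \<le> x\<^sup>2 + y\<^sup>2" for x y :: real
  proof -
    have "0 \<le> (\<bar>x\<bar> - \<bar>y\<bar>)\<^sup>2" by simp
    then have "2 * \<bar>x * y\<bar> \<le> x\<^sup>2 + y\<^sup>2" by (simp add: power2_diff abs_mult)
    moreover have "0 \<le> \<bar>x * y\<bar>" by simp
    ultimately show ?thesis by linarith
  qed
  then show "AE \<omega> in M. norm (X \<omega> * Y \<omega>) \<le> norm ((X \<omega>)\<^sup>2 + (Y \<omega>)\<^sup>2)" by simp
qed simp

text \<open>The indices \<open>0\<close> and \<open>1\<close> are left out: the weight \<open>(ln k)\<^sup>2\<close> vanishes at \<open>k = 1\<close>, so
  the first variable may have infinite variance.\<close>
locale orthogonal_sequence =
  fixes M :: "'w measure" and X :: "nat \<Rightarrow> 'w \<Rightarrow> real"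
  assumes measurable_X [measurable]: "\<And>k. X k \<in> borel_measurable M"
    and integrable_X_sq: "\<And>k. k \<ge> 2 \<Longrightarrow> integrable M (\<lambda>\<omega>. (X k \<omega>)\<^sup>2)"
    and orthogonal: "\<And>j k. j \<ge> 2 \<Longrightarrow> k \<ge> 2 \<Longrightarrow> j \<noteq> k \<Longrightarrow> (\<integral>\<omega>. X j \<omega> * X k \<omega> \<partial>M) = 0"
begin

definition second_moment :: "nat \<Rightarrow> real" where
  "second_moment k = (\<integral>\<omega>. (X k \<omega>)\<^sup>2 \<partial>M)"

lemma second_moment_nonneg: "0 \<le> second_moment k"
  by (simp add: second_moment_def)

lemma
  assumes "finite I" "I \<subseteq> {2..}"
  shows integrable_sum_sq: "integrable M (\<lambda>\<omega>. (\<Sum>k\<in>I. X k \<omega>)\<^sup>2)"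
    and integral_sum_sq: "(\<integral>\<omega>. (\<Sum>k\<in>I. X k \<omega>)\<^sup>2 \<partial>M) = (\<Sum>k\<in>I. second_moment k)"
proof -
  have eq: "(\<Sum>k\<in>I. X k \<omega>)\<^sup>2 = (\<Sum>j\<in>I. \<Sum>k\<in>I. X j \<omega> * X k \<omega>)" for \<omega>
    by (simp add: power2_eq_square sum_product)
  have int: "integrable M (\<lambda>\<omega>. X j \<omega> * X k \<omega>)" if "j \<in> I" "k \<in> I" for j k
    using that assms by (intro integrable_mult_of_squares integrable_X_sq) auto
  then show "integrable M (\<lambda>\<omega>. (\<Sum>k\<in>I. X k \<omega>)\<^sup>2)"
    unfolding eq by simp
  have "(\<integral>\<omega>. (\<Sum>k\<in>I. X k \<omega>)\<^sup>2 \<partial>M) = (\<Sum>j\<in>I. \<Sum>k\<in>I. (\<integral>\<omega>. X j \<omega> * X k \<omega> \<partial>M))"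
    unfolding eq using int by simp
  also have "\<dots> = (\<Sum>j\<in>I. \<Sum>k\<in>I. if k = j then second_moment j else 0)"
    using assms orthogonal
    by (intro sum.cong refl) (auto simp: second_moment_def power2_eq_square subset_eq)
  also have "\<dots> = (\<Sum>j\<in>I. second_moment j)"
    using assms by (simp add: sum.delta)
  finally show "(\<integral>\<omega>. (\<Sum>k\<in>I. X k \<omega>)\<^sup>2 \<partial>M) = (\<Sum>k\<in>I. second_moment k)" .
qed

text \<open>The subblocks of each level partition \<open>{a..<a + 2 ^ m}\<close>, so by
  orthogonality every one of the m + 1 levels contributes the full sum of second moments.\<close>

lemma
  assumes "a \<ge> 2"
  shows integrable_dyadic_sq: "integrable M (\<lambda>\<omega>. dyadic_sq (\<lambda>k. X k \<omega>) m a)"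
    and integral_dyadic_sq: "(\<integral>\<omega>. dyadic_sq (\<lambda>k. X k \<omega>) m a \<partial>M) =
      (real m + 1) * (\<Sum>k\<in>{a..<a + 2 ^ m}. second_moment k)"
  using assms
proof (induction m arbitrary: a)
  case 0
  {
    case 1 then show ?case by (simp add: integrable_X_sq)
  next
    case 2 then show ?case by (simp add: second_moment_def)
  }
next
  case (Suc m)
  {
    case 1
    then have "integrable M (\<lambda>\<omega>. (\<Sum>k\<in>{a..<a + 2 ^ Suc m}. X k \<omega>)\<^sup>2)"
      by (intro integrable_sum_sq) auto
    then show ?case using 1 Suc.IH(1)[of a] Suc.IH(1)[of "a + 2 ^ m"] by simp
  next
    case 2
    let ?s = "\<lambda>A. \<Sum>k\<in>A. second_moment k"
    have I: "{a..<a + 2 ^ Suc m} \<subseteq> {2..}" using 2 by auto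
    have "{a..<a + 2 ^ Suc m} = {a..<a + 2 ^ m} \<union> {a + 2 ^ m..<a + 2 ^ m + 2 ^ m}" by auto
    then have split: "?s {a..<a + 2 ^ Suc m} =
        ?s {a..<a + 2 ^ m} + ?s {a + 2 ^ m..<a + 2 ^ m + 2 ^ m}"
      by (simp only:) (intro sum.union_disjoint; auto)
    have "(\<integral>\<omega>. dyadic_sq (\<lambda>k. X k \<omega>) (Suc m) a \<partial>M) =
        (\<integral>\<omega>. (\<Sum>k\<in>{a..<a + 2 ^ Suc m}. X k \<omega>)\<^sup>2 \<partial>M) +
        (\<integral>\<omega>. dyadic_sq (\<lambda>k. X k \<omega>) m a \<partial>M) +
        (\<integral>\<omega>. dyadic_sq (\<lambda>k. X k \<omega>) m (a + 2 ^ m) \<partial>M)"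
      unfolding dyadic_sq.simps
      using 2 integrable_sum_sq[OF _ I] Suc.IH(1)[of a] Suc.IH(1)[of "a + 2 ^ m"]
      by (subst Bochner_Integration.integral_add | simp)+
    also have "\<dots> = (real (Suc m) + 1) * ?s {a..<a + 2 ^ Suc m}"
      using 2 integral_sum_sq[OF _ I] Suc.IH(2)[of a] Suc.IH(2)[of "a + 2 ^ m"]
      unfolding split by (simp add: algebra_simps)
    finally show ?case .
  }
qed

end

section \<open>From the weighted series to almost sure convergence\<close>

text \<open>Controls the sums at the dyadic times themselves. Passing from j to j + 1 divides the
  old average by 4 and adds a quarter of the new block, and B/3 is the fixed point of s = s/4 +
  B/4.\<close>

lemma dyadic_average_bound:
  fixes v :: "nat \<Rightarrow> real"
  assumes v: "\<And>k. 0 \<le> v k" and B: "\<And>J. (\<Sum>j<J. (\<Sum>k\<in>{2 ^ j<..2 ^ Suc j}. v k) / 4 ^ j) \<le> B"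
  shows "(\<Sum>j<J. (\<Sum>k\<in>{2..2 ^ j}. v k) / 4 ^ j) \<le> B / 3"
proof (induction J)
  case 0
  then show ?case using B[of 0] by simp
next
  case (Suc J)
  let ?u = "\<lambda>j. (\<Sum>k\<in>{2..2 ^ j}. v k) / 4 ^ j"
  let ?b = "\<lambda>j. (\<Sum>k\<in>{2 ^ j<..2 ^ Suc j}. v k) / 4 ^ j"
  have step: "?u (Suc j) = ?u j / 4 + ?b j / 4" for j
  proof -
    have "{2..2 ^ Suc j} = {2..2 ^ j} \<union> {2 ^ j<..2 ^ Suc j :: nat}"
    proof (cases j)
      case (Suc i)
      have "2 \<le> (2::nat) ^ j" using Suc by simp
      then show ?thesis by auto
    qed auto
    then have "(\<Sum>k\<in>{2..2 ^ Suc j}. v k) = (\<Sum>k\<in>{2..2 ^ j}. v k) + (\<Sum>k\<in>{2 ^ j<..2 ^ Suc j}. v k)"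
      by (simp only:) (intro sum.union_disjoint; auto)
    then show ?thesis by (simp add: field_simps)
  qed
  have "(\<Sum>j<Suc J. ?u j) = ?u 0 + (\<Sum>j<J. ?u (Suc j))"
    by (rule sum.lessThan_Suc_shift)
  \<comment> \<open>The term \<open>?u 0\<close> is an empty sum, since its range is
    \<open>{2..1}\<close>.\<close>
  also have "\<dots> = (\<Sum>j<J. ?u j) / 4 + (\<Sum>j<J. ?b j) / 4"
    unfolding step by (simp add: sum.distrib sum_divide_distrib)
  also have "\<dots> \<le> (B / 3) / 4 + B / 4"
    using Suc.IH B[of J] by linarith
  finally show ?case by simp
qed

text \<open>Stands in for Chebyshev and Borel--Cantelli: the series of the \<open>Z j\<close> has a
  finite integral, so it converges almost everywhere and its terms vanish in the limit.\<close>

lemma AE_tendsto_zero_of_summable_integrals: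
  fixes Z :: "nat \<Rightarrow> 'w \<Rightarrow> real"
  assumes int: "\<And>j. integrable M (Z j)" and nn: "\<And>j \<omega>. 0 \<le> Z j \<omega>"
    and sum: "summable (\<lambda>j. \<integral>\<omega>. Z j \<omega> \<partial>M)"
  shows "AE \<omega> in M. (\<lambda>j. Z j \<omega>) \<longlonglongrightarrow> 0"
proof -
  have [measurable]: "Z j \<in> borel_measurable M" for j using int by auto
  have "(\<integral>\<^sup>+\<omega>. (\<Sum>j. ennreal (Z j \<omega>)) \<partial>M) = (\<Sum>j. \<integral>\<^sup>+\<omega>. ennreal (Z j \<omega>) \<partial>M)"
    by (rule nn_integral_suminf) simp
  also have "\<dots> = (\<Sum>j. ennreal (\<integral>\<omega>. Z j \<omega> \<partial>M))"
    using int nn by (simp add: nn_integral_eq_integral)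
  also have "\<dots> = ennreal (\<Sum>j. \<integral>\<omega>. Z j \<omega> \<partial>M)"
    using nn sum by (intro suminf_ennreal2) (auto intro: integral_nonneg_AE)
  finally have "(\<integral>\<^sup>+\<omega>. (\<Sum>j. ennreal (Z j \<omega>)) \<partial>M) \<noteq> \<infinity>" by simp
  then have "AE \<omega> in M. (\<Sum>j. ennreal (Z j \<omega>)) \<noteq> \<infinity>"
    by (intro nn_integral_PInf_AE) auto
  then show ?thesis
  proof eventually_elim
    case (elim \<omega>)
    then have "summable (\<lambda>j. Z j \<omega>)"
      using nn by (intro summable_suminf_not_top) auto
    then show ?case by (rule summable_LIMSEQ_zero)
  qed
qed

lemma obtain_dyadic_block:
  fixes n :: nat
  assumes "n \<ge> 2"
  obtains j where "2 ^ j < n" "n \<le> 2 ^ Suc j"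
proof -
  define P where "P i \<longleftrightarrow> n \<le> 2 ^ i" for i
  have "P n" by (simp add: P_def)
  moreover have "\<not> P 0" using assms by (simp add: P_def)
  ultimately obtain j where "\<not> P j" "P (Suc j)"
    using ex_least_nat_less[of P n] by blast
  then show thesis using that[of j] by (auto simp: P_def not_le)
qed

context orthogonal_sequence
begin

text \<open>On the block from 2^j to 2^(j+1), k is comparable with 2^j and ln k with j + 1. So the
  factor (j + 1)^2 of the maximal inequality is absorbed by the logarithmic weight.\<close>

lemma block_second_moment_bound:
  assumes "summable (\<lambda>k. second_moment k * (ln (real k))\<^sup>2 / (real k)\<^sup>2)"
  obtains B where
    "\<And>J. (\<Sum>j<J. (real j + 1)\<^sup>2 * (\<Sum>k\<in>{2 ^ j<..2 ^ Suc j}. second_moment k) / 4 ^ j) \<le> B"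
proof -
  define w where "w k = second_moment k * (ln (real k))\<^sup>2 / (real k)\<^sup>2" for k
  \<comment> \<open>16 is 4 times 4: one factor from k^2 \<le> 4 * 4^j, the other from squaring (j +
    1) ln 2 \<le> 2 ln k.\<close>
  define c :: real where "c = 16 / (ln 2)\<^sup>2"
  have w: "0 \<le> w k" for k by (simp add: w_def second_moment_nonneg)
  have term_le: "(real j + 1)\<^sup>2 * second_moment k / 4 ^ j \<le> c * w k"
    if k: "2 ^ j < k" "k \<le> 2 ^ Suc j" for j k
  proof -
    have "1 \<le> (2::nat) ^ j" by simp
    with k(1) have k2: "2 \<le> k" by linarith
    then have k0: "0 < real k" by simp
    have "real (2 ^ j) < real k" "real k \<le> real (2 ^ Suc j)"
      using k by (simp_all only: of_nat_less_iff of_nat_le_iff)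
    then have k_real: "2 ^ j < real k" "real k \<le> 2 ^ Suc j" by simp_all
    have "(real k)\<^sup>2 \<le> (2 ^ Suc j)\<^sup>2"
      using k_real(2) by (intro power_mono) auto
    then have a: "1 / 4 ^ j \<le> 4 / (real k)\<^sup>2"
      using k0 by (simp add: field_simps power2_eq_square flip: power_mult_distrib)
    have "ln (2 ^ j) \<le> ln (real k)"
      using k_real(1) by (intro ln_mono) auto
    then have "real j * ln 2 \<le> ln (real k)" by (simp add: ln_realpow)
    \<comment> \<open>Added to the previous bound, this turns j into j + 1; for j = 0 the previous
      bound alone says only that ln k is nonnegative.\<close>
    moreover have "ln 2 \<le> ln (real k)" using k2 by simp
    ultimately have "(real j + 1) * ln 2 \<le> 2 * ln (real k)" by (simp add: algebra_simps)
    then have "((real j + 1) * ln 2)\<^sup>2 \<le> (2 * ln (real k))\<^sup>2"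
      by (intro power_mono) auto
    then have b: "(real j + 1)\<^sup>2 \<le> 4 * (ln (real k))\<^sup>2 / (ln 2)\<^sup>2"
      by (simp only: power_mult_distrib) (simp add: field_simps)
    have "(real j + 1)\<^sup>2 * (1 / 4 ^ j) \<le> (4 * (ln (real k))\<^sup>2 / (ln 2)\<^sup>2) * (4 / (real k)\<^sup>2)"
      by (intro mult_mono a b) auto
    then have "second_moment k * ((real j + 1)\<^sup>2 * (1 / 4 ^ j)) \<le>
        second_moment k * ((4 * (ln (real k))\<^sup>2 / (ln 2)\<^sup>2) * (4 / (real k)\<^sup>2))"
      by (intro mult_left_mono second_moment_nonneg)
    then show ?thesis by (simp add: w_def c_def mult_ac)
  qed
  have block: "(real j + 1)\<^sup>2 * (\<Sum>k\<in>{2 ^ j<..2 ^ Suc j}. second_moment k) / 4 ^ j \<le>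
      c * (\<Sum>k\<in>{2 ^ j<..2 ^ Suc j}. w k)" for j
    unfolding sum_distrib_left sum_divide_distrib using term_le by (intro sum_mono) auto
  have blocks: "(\<Sum>j<J. \<Sum>k\<in>{2 ^ j<..2 ^ Suc j}. w k) \<le> (\<Sum>k\<le>2 ^ J. w k)" for J :: nat
  proof (induction J)
    case (Suc J)
    have "{..2 ^ Suc J} = {..2 ^ J} \<union> {2 ^ J<..2 ^ Suc J :: nat}" by auto
    then have "(\<Sum>k\<le>2 ^ Suc J. w k) = (\<Sum>k\<le>2 ^ J. w k) + (\<Sum>k\<in>{2 ^ J<..2 ^ Suc J}. w k)"
      by (simp only:) (intro sum.union_disjoint; auto)
    with Suc show ?case by simp
  qed (simp add: w sum_nonneg)
  have "(\<Sum>j<J. (real j + 1)\<^sup>2 * (\<Sum>k\<in>{2 ^ j<..2 ^ Suc j}. second_moment k) / 4 ^ j)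
      \<le> c * (\<Sum>k. w k)" for J
  proof -
    have "(\<Sum>j<J. (real j + 1)\<^sup>2 * (\<Sum>k\<in>{2 ^ j<..2 ^ Suc j}. second_moment k) / 4 ^ j) \<le>
        c * (\<Sum>j<J. \<Sum>k\<in>{2 ^ j<..2 ^ Suc j}. w k)"
      unfolding sum_distrib_left[of c] by (intro sum_mono block[unfolded sum_distrib_left[of c]])
    also have "\<dots> \<le> c * (\<Sum>k. w k)"
    proof (rule mult_left_mono)
      have "summable w" using assms by (simp add: w_def[abs_def])
      then have "(\<Sum>k\<le>2 ^ J. w k) \<le> (\<Sum>k. w k)" using w by (intro sum_le_suminf) auto
      with blocks[of J] show "(\<Sum>j<J. \<Sum>k\<in>{2 ^ j<..2 ^ Suc j}. w k) \<le> (\<Sum>k. w k)" by linarith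
    qed (simp add: c_def)
    finally show ?thesis .
  qed
  then show thesis by (rule that)
qed

text \<open>Every n \<ge> 2 lies in one block, and its sum is the sum up to 2^j plus an initial
  segment of the block. Both squares, divided by 4^j, are dominated by \<open>Z j\<close>, so
  summability of the integrals of the \<open>Z j\<close> is enough.\<close>

theorem strong_law:
  assumes summ: "summable (\<lambda>k. second_moment k * (ln (real k))\<^sup>2 / (real k)\<^sup>2)"
  shows "AE \<omega> in M. (\<lambda>n. (\<Sum>k=2..n. X k \<omega>) / real n) \<longlonglongrightarrow> 0"
proof -
  \<comment> \<open>The first term handles the dyadic time 2^j, the second all increments over the
    following block simultaneously.\<close>
  define Z where "Z j \<omega> = (\<Sum>k=2..2 ^ j. X k \<omega>)\<^sup>2 / 4 ^ j +
      (real j + 1) * dyadic_sq (\<lambda>k. X k \<omega>) j (2 ^ j + 1) / 4 ^ j" for j \<omega>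
  let ?b = "\<lambda>j. \<Sum>k\<in>{2 ^ j<..2 ^ Suc j}. second_moment k"
  obtain B where B: "\<And>J. (\<Sum>j<J. (real j + 1)\<^sup>2 * ?b j / 4 ^ j) \<le> B"
    using block_second_moment_bound[OF summ] by blast
  have two: "2 \<le> (2::nat) ^ j + 1" for j by simp
  have Z_nonneg: "0 \<le> Z j \<omega>" for j \<omega> by (simp add: Z_def dyadic_sq_nonneg)
  have int1: "integrable M (\<lambda>\<omega>. (\<Sum>k=2..2 ^ j. X k \<omega>)\<^sup>2)" for j
    by (rule integrable_sum_sq) auto
  note int2 = integrable_dyadic_sq[OF two]
  have Z_int: "integrable M (Z j)" for j
    unfolding Z_def using int1[of j] int2[of j j] by simp
  have EZ: "(\<integral>\<omega>. Z j \<omega> \<partial>M) = (\<Sum>k=2..2 ^ j. second_moment k) / 4 ^ j +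
      (real j + 1)\<^sup>2 * ?b j / 4 ^ j" for j
  proof -
    have "{2 ^ j + 1..<2 ^ j + 1 + 2 ^ j} = {2 ^ j<..2 ^ Suc j :: nat}" by auto
    moreover have "(\<integral>\<omega>. (\<Sum>k=2..2 ^ j. X k \<omega>)\<^sup>2 \<partial>M) = (\<Sum>k=2..2 ^ j. second_moment k)"
      by (rule integral_sum_sq) auto
    ultimately show ?thesis
      unfolding Z_def using int1[of j] int2[of j j] integral_dyadic_sq[OF two, of j j]
      by (simp add: power2_eq_square mult.assoc)
  qed
  \<comment> \<open>The unweighted bound that \<open>dyadic_average_bound\<close> asks for, obtained
    by dropping a factor that is at least 1.\<close>
  have b: "(\<Sum>j<J. ?b j / 4 ^ j) \<le> B" for J
  proof (rule order_trans[OF sum_mono B[of J]])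
    fix j
    have "1 * (?b j / 4 ^ j) \<le> (real j + 1)\<^sup>2 * (?b j / 4 ^ j)"
      by (intro mult_right_mono) (auto intro!: divide_nonneg_pos sum_nonneg second_moment_nonneg)
    then show "?b j / 4 ^ j \<le> (real j + 1)\<^sup>2 * ?b j / 4 ^ j" by simp
  qed
  have "summable (\<lambda>j. \<integral>\<omega>. Z j \<omega> \<partial>M)"
  proof (rule bounded_imp_summable)
    show "0 \<le> (\<integral>\<omega>. Z j \<omega> \<partial>M)" for j by (intro integral_nonneg_AE AE_I2 Z_nonneg)
    fix J :: nat
    have "(\<Sum>j<Suc J. \<integral>\<omega>. Z j \<omega> \<partial>M) \<le> B / 3 + B"
      unfolding EZ sum.distrib
      using dyadic_average_bound[OF second_moment_nonneg b, of "Suc J"] B[of "Suc J"]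
      by linarith
    then show "(\<Sum>j\<le>J. \<integral>\<omega>. Z j \<omega> \<partial>M) \<le> B / 3 + B" by (simp add: lessThan_Suc_atMost)
  qed
  then have "AE \<omega> in M. (\<lambda>j. Z j \<omega>) \<longlonglongrightarrow> 0"
    by (intro AE_tendsto_zero_of_summable_integrals Z_int Z_nonneg)
  then show ?thesis
  proof eventually_elim
    case (elim \<omega>)
    let ?S = "\<lambda>n. \<Sum>k=2..n. X k \<omega>"
    have key: "(?S n / real n)\<^sup>2 \<le> 2 * Z j \<omega>" if n: "2 ^ j < n" "n \<le> 2 ^ Suc j" for n j
    proof -
      define r where "r = (\<Sum>k\<in>{2 ^ j + 1..<2 ^ j + 1 + (n - 2 ^ j)}. X k \<omega>)"
      have "{2..n} = {2..2 ^ j} \<union> {2 ^ j + 1..<2 ^ j + 1 + (n - 2 ^ j)}"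
        using n two[of j] by (auto simp del: one_le_power)
      then have S: "?S n = ?S (2 ^ j) + r"
        unfolding r_def by (simp only:) (intro sum.union_disjoint; auto)
      have r: "r\<^sup>2 \<le> (real j + 1) * dyadic_sq (\<lambda>k. X k \<omega>) j (2 ^ j + 1)"
        unfolding r_def by (rule partial_sum_sq_le_dyadic_sq) (use n in auto)
      have "real (2 ^ j) \<le> real n"
        using n(1) by (simp only: of_nat_le_iff)
      then have "(2 ^ j)\<^sup>2 \<le> (real n)\<^sup>2"
        by (intro power_mono) auto
      then have "4 ^ j \<le> (real n)\<^sup>2"
        by (simp add: power2_eq_square flip: power_mult_distrib)
      then have frac: "(?S n / real n)\<^sup>2 \<le> (?S n)\<^sup>2 / 4 ^ j"
        by (simp add: power_divide frac_le)
      \<comment> \<open>The factor 2 in \<open>key\<close> comes from (p + q)^2 \<le> 2 p^2 + 2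
        q^2.\<close>
      have "(?S n)\<^sup>2 \<le> 2 * (?S (2 ^ j))\<^sup>2 + 2 * r\<^sup>2"
        unfolding S using sum_squares_bound[of "?S (2 ^ j)" r] by (simp add: power2_sum)
      with frac have "(?S n / real n)\<^sup>2 \<le> (2 * (?S (2 ^ j))\<^sup>2 + 2 * r\<^sup>2) / 4 ^ j"
        by (meson divide_right_mono order_trans zero_le_numeral zero_le_power)
      also have "\<dots> \<le> 2 * Z j \<omega>"
        using r by (simp add: Z_def divide_simps)
      finally show ?thesis .
    qed
    show ?case
    proof (rule LIMSEQ_I)
      fix \<epsilon> :: real assume "\<epsilon> > 0"
      then have "\<epsilon>\<^sup>2 / 2 > 0" by simp
      from LIMSEQ_D[OF elim this] obtain J where J: "\<And>j. j \<ge> J \<Longrightarrow> Z j \<omega> < \<epsilon>\<^sup>2 / 2"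
        using Z_nonneg by auto
      show "\<exists>N. \<forall>n\<ge>N. norm (?S n / real n - 0) < \<epsilon>"
      proof (intro exI allI impI)
        fix n :: nat assume n: "2 ^ Suc J \<le> n"
        moreover have "(2::nat) \<le> 2 ^ Suc J" by simp
        ultimately have "2 \<le> n" by linarith
        then obtain j where j: "2 ^ j < n" "n \<le> 2 ^ Suc j" by (rule obtain_dyadic_block)
        with n have "(2::nat) ^ Suc J \<le> 2 ^ Suc j" by linarith
        then have "J \<le> j" by simp
        with key[OF j] J[of j] have "(?S n / real n)\<^sup>2 < \<epsilon>\<^sup>2" by linarith
        then show "norm (?S n / real n - 0) < \<epsilon>"
          using \<open>\<epsilon> > 0\<close> by (metis abs_of_pos abs_le_square_iff diff_zero linorder_not_le real_norm_def)
      qed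
    qed
  qed
qed

end

section \<open>Convex separation in finite dimension\<close>

definition sublinear :: "('a::real_vector \<Rightarrow> real) \<Rightarrow> bool" where
  "sublinear q \<longleftrightarrow> (\<forall>v w. q (v + w) \<le> q v + q w) \<and> (\<forall>t\<ge>0. \<forall>v. q (t *\<^sub>R v) = t * q v)"

text \<open>One inequality for all positive t suffices: its instance for 1/t is the converse
  one.\<close>

lemma sublinearI:
  assumes "\<And>v w. q (v + w) \<le> q v + q w" and "\<And>t v. t > 0 \<Longrightarrow> q (t *\<^sub>R v) \<le> t * q v" and "q 0 = 0"
  shows "sublinear q"
proof -
  have "q (t *\<^sub>R v) = t * q v" if t: "t \<ge> 0" for t v
  proof (cases "t = 0")
    case False
    with t have t: "t > 0" by simp
    have "q v = q (inverse t *\<^sub>R t *\<^sub>R v)" using t by simp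
    also have "\<dots> \<le> inverse t * q (t *\<^sub>R v)" using t by (intro assms(2)) simp
    finally have "t * q v \<le> q (t *\<^sub>R v)" using t by (simp add: field_simps)
    with assms(2)[OF t, of v] show ?thesis by simp
  qed (simp add: assms(3))
  then show ?thesis using assms(1) by (simp add: sublinear_def)
qed

lemma sublinear_add: "sublinear q \<Longrightarrow> q (v + w) \<le> q v + q w"
  by (simp add: sublinear_def)

lemma sublinear_scaleR: "sublinear q \<Longrightarrow> t \<ge> 0 \<Longrightarrow> q (t *\<^sub>R v) = t * q v"
  by (simp add: sublinear_def)

lemma sublinear_0: "sublinear q \<Longrightarrow> q 0 = 0"
  using sublinear_scaleR[of q 0 0] by simp

lemma sublinear_minus: "sublinear q \<Longrightarrow> - q (- v) \<le> q v"
  using sublinear_add[of q v "- v"] sublinear_0[of q] by simp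

text \<open>The lowering step. Taking t = 0 at \<open>a\<close> and t = 1 at \<open>- a\<close>
  bounds the two new values by \<open>q a\<close> and \<open>- q a\<close>. Sublinearity supplies
  the opposite inequality for their sum, so the lowered functional is linear on the line through
  \<open>a\<close>.\<close>

lemma sublinear_linear_on_direction:
  fixes q :: "'a::real_vector \<Rightarrow> real"
  assumes q: "sublinear q"
  obtains q' where "sublinear q'" "\<And>v. q' v \<le> q v" "q' a + q' (- a) \<le> 0"
proof -
  define q' where "q' v = (INF t\<in>{0..}. q (v + t *\<^sub>R a) - t * q a)" for v
  \<comment> \<open>A bound independent of \<open>t\<close>, so the real infimum is a genuine
    one.\<close>
  have lower: "- q (- v) \<le> q (v + t *\<^sub>R a) - t * q a" if "t \<ge> 0" for v t
    using sublinear_add[OF q, of "v + t *\<^sub>R a" "- v"] sublinear_scaleR[OF q that, of a] by simp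
  then have bdd: "bdd_below ((\<lambda>t. q (v + t *\<^sub>R a) - t * q a) ` {0..})" for v
    by (intro bdd_belowI2) auto
  have upper: "q' v \<le> q (v + t *\<^sub>R a) - t * q a" if "t \<ge> 0" for v t
    unfolding q'_def using that by (intro cINF_lower bdd) auto
  have greatest: "c \<le> q' v" if "\<And>t. t \<ge> 0 \<Longrightarrow> c \<le> q (v + t *\<^sub>R a) - t * q a" for c v
    unfolding q'_def using that by (intro cINF_greatest) auto
  show thesis
  proof (rule that[of q'])
    show "sublinear q'"
    proof (rule sublinearI)
      fix v w
      have "q' (v + w) - (q (v + t *\<^sub>R a) - t * q a) \<le> q (w + s *\<^sub>R a) - s * q a"
        if "t \<ge> 0" "s \<ge> 0" for s t
      proof -
        have "q' (v + w) \<le> q ((v + w) + (t + s) *\<^sub>R a) - (t + s) * q a"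
          using that by (intro upper) auto
        also have "(v + w) + (t + s) *\<^sub>R a = (v + t *\<^sub>R a) + (w + s *\<^sub>R a)"
          by (simp add: scaleR_add_left)
        finally show ?thesis
          using sublinear_add[OF q, of "v + t *\<^sub>R a" "w + s *\<^sub>R a"] by (simp add: distrib_right)
      qed
      then have "q' (v + w) - (q (v + t *\<^sub>R a) - t * q a) \<le> q' w" if "t \<ge> 0" for t
        using that by (intro greatest) auto
      then have "q' (v + w) - q' w \<le> q' v"
        by (intro greatest) (force simp: algebra_simps)
      then show "q' (v + w) \<le> q' v + q' w" by simp
    next
      fix t :: real and v assume t: "t > 0"
      have "q' (t *\<^sub>R v) / t \<le> q' v"
      proof (rule greatest)
        fix s :: real assume s: "s \<ge> 0"
        have "q' (t *\<^sub>R v) \<le> q (t *\<^sub>R v + (t * s) *\<^sub>R a) - (t * s) * q a"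
          using s t by (intro upper) simp
        also have "t *\<^sub>R v + (t * s) *\<^sub>R a = t *\<^sub>R (v + s *\<^sub>R a)"
          by (simp add: scaleR_add_right)
        also have "q \<dots> = t * q (v + s *\<^sub>R a)"
          using t by (intro sublinear_scaleR[OF q]) simp
        finally show "q' (t *\<^sub>R v) / t \<le> q (v + s *\<^sub>R a) - s * q a"
          using t by (simp add: field_simps)
      qed
      then show "q' (t *\<^sub>R v) \<le> t * q' v" using t by (simp add: field_simps)
    next
      have "q' 0 \<le> 0" using upper[of 0 0] sublinear_0[OF q] by simp
      moreover have "0 \<le> q' 0" using lower[of _ 0] sublinear_0[OF q] by (intro greatest) simp
      ultimately show "q' 0 = 0" by simp
    qed
    show "q' v \<le> q v" for v using upper[of 0 v] by simp
    have "q' a \<le> q a" using upper[of 0 a] by simp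
    moreover have "q' (- a) \<le> - q a" using upper[of 1 "- a"] sublinear_0[OF q] by simp
    ultimately show "q' a + q' (- a) \<le> 0" by linarith
  qed
qed

text \<open>Hahn--Banach without Zorn's lemma: the sublinear functional is lowered once for every element
  of a finite spanning set, after which it is linear.\<close>
lemma sublinear_dominates_linear:
  fixes q :: "'a::real_vector \<Rightarrow> real"
  assumes B: "finite B" "span B = (UNIV :: 'a set)" and q: "sublinear q"
  obtains f where "linear f" "\<And>v. f v \<le> q v"
proof -
  have "\<exists>f. sublinear f \<and> (\<forall>v. f v \<le> q v) \<and> (\<forall>b\<in>B. f b + f (- b) \<le> 0)"
    using B(1)
  proof (induction B)
    case empty
    then show ?case using q by blast
  next
    case (insert b B)
    then obtain g where g: "sublinear g" "\<And>v. g v \<le> q v" "\<And>b. b \<in> B \<Longrightarrow> g b + g (- b) \<le> 0"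
      by blast
    obtain f where f: "sublinear f" "\<And>v. f v \<le> g v" "f b + f (- b) \<le> 0"
      using sublinear_linear_on_direction[OF g(1), of b] by blast
    \<comment> \<open>Directions treated earlier stay linear, because the condition is preserved
      under further lowering.\<close>
    have "f c + f (- c) \<le> 0" if "c \<in> B" for c
      using f(2)[of c] f(2)[of "- c"] g(3)[OF that] by linarith
    then show ?case using f g(2) by (intro exI[of _ f]) (auto intro: order_trans)
  qed
  then obtain f where f: "sublinear f" "\<And>v. f v \<le> q v" "\<And>b. b \<in> B \<Longrightarrow> f b + f (- b) \<le> 0"
    by blast
  \<comment> \<open>The vectors on which \<open>f\<close> is odd form a subspace, so a spanning set
    decides.\<close>
  have "subspace {v. f v + f (- v) \<le> 0}"
  proof (rule subspaceI)
    show "0 \<in> {v. f v + f (- v) \<le> 0}" using sublinear_0[OF f(1)] by simp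
  next
    fix v w assume "v \<in> {v. f v + f (- v) \<le> 0}" "w \<in> {v. f v + f (- v) \<le> 0}"
    then show "v + w \<in> {v. f v + f (- v) \<le> 0}"
      using sublinear_add[OF f(1), of v w] sublinear_add[OF f(1), of "- v" "- w"] by simp
  next
    fix c v assume v: "v \<in> {v. f v + f (- v) \<le> 0}"
    have "f (\<bar>c\<bar> *\<^sub>R v) + f (\<bar>c\<bar> *\<^sub>R (- v)) = \<bar>c\<bar> * (f v + f (- v))"
      using sublinear_scaleR[OF f(1), of "\<bar>c\<bar>"] by (simp add: distrib_left del: scaleR_minus_right)
    also have "\<dots> \<le> 0" using v by (simp add: mult_nonneg_nonpos)
    finally show "c *\<^sub>R v \<in> {v. f v + f (- v) \<le> 0}" by (cases "c \<ge> 0") (auto simp: add.commute)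
  qed
  with f(3) have "span B \<subseteq> {v. f v + f (- v) \<le> 0}" by (intro span_minimal) auto
  with B(2) have "f v + f (- v) \<le> 0" for v by auto
  then have neg: "f (- v) = - f v" for v
    using sublinear_minus[OF f(1), of v] by (smt (verit))
  have "linear f"
  proof
    fix v w
    have "f (v + w) \<ge> f v + f w"
      using sublinear_add[OF f(1), of "- v" "- w"] neg[of "v + w"] neg[of v] neg[of w] by simp
    then show "f (v + w) = f v + f w" using sublinear_add[OF f(1), of v w] by simp
  next
    fix c v
    show "f (c *\<^sub>R v) = c *\<^sub>R f v"
    proof (cases "c \<ge> 0")
      case False
      then show ?thesis
        using sublinear_scaleR[OF f(1), of "- c" v] neg[of "c *\<^sub>R v"] by simp
    qed (simp add: sublinear_scaleR[OF f(1)])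
  qed
  then show thesis using f(2) by (rule that)
qed

section \<open>Separation of a point from a convex set\<close>

text \<open>The functional \<open>q\<close> in the proof is the greatest sublinear one that lies
  below the norm and is at most -r at every a - p with \<open>a\<close> in \<open>A\<close>. A
  linear functional below it therefore has norm at most 1 and separates with the full distance r.
  Asking for the ball rather than the sphere includes r = 0.\<close>

lemma infdist_separation:
  fixes A :: "'a::real_normed_vector set"
  assumes B: "finite B" "span B = (UNIV :: 'a set)" and A: "convex A" "A \<noteq> {}"
  obtains x :: "'a \<Rightarrow>\<^sub>L real" where "norm x \<le> 1" "\<And>a. a \<in> A \<Longrightarrow> x a \<le> x p - infdist p A"
proof -
  define r where "r = infdist p A"
  have r: "r \<le> norm (a - p)" if "a \<in> A" for a
    unfolding r_def using infdist_le[OF that, of p] by (simp add: dist_norm norm_minus_commute)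
  define S where "S = {0::real..} \<times> A"
  define h where "h v = (\<lambda>(t, a). norm (v - t *\<^sub>R (a - p)) - r * t)" for v
  define q where "q v = (INF s\<in>S. h v s)" for v
  have S: "S \<noteq> {}" using A by (auto simp: S_def)
  have lower: "- norm v \<le> h v s" if s: "s \<in> S" for v s
  proof -
    obtain t a where s: "s = (t, a)" "t \<ge> 0" "a \<in> A" using s by (auto simp: S_def)
    \<comment> \<open>This is where r being the distance matters: a larger r could make the infimum
      defining \<open>q\<close> infinite.\<close>
    have "t * r \<le> t * norm (a - p)" using s r by (intro mult_left_mono) auto
    also have "\<dots> = norm (t *\<^sub>R (a - p))" using s by simp
    also have "\<dots> \<le> norm v + norm (v - t *\<^sub>R (a - p))"
      by (metis norm_minus_commute norm_triangle_sub)
    finally show ?thesis by (simp add: h_def s mult.commute)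
  qed
  then have bdd: "bdd_below (h v ` S)" for v by (intro bdd_belowI2)
  have upper: "q v \<le> h v s" if "s \<in> S" for v s
    unfolding q_def using that by (intro cINF_lower bdd)
  have greatest: "c \<le> q v" if "\<And>s. s \<in> S \<Longrightarrow> c \<le> h v s" for c v
    unfolding q_def using that S by (intro cINF_greatest)
  have q_le_norm: "q v \<le> norm v" for v
  proof -
    obtain a where "a \<in> A" using A by auto
    then show ?thesis using upper[of "(0, a)" v] by (simp add: S_def h_def)
  qed
  have "sublinear q"
  proof (rule sublinearI)
    fix v w
    have "q (v + w) - h v s1 \<le> h w s2" if s12: "s1 \<in> S" "s2 \<in> S" for s1 s2
    proof -
      obtain t1 a1 where s1: "s1 = (t1, a1)" "t1 \<ge> 0" "a1 \<in> A" using s12 by (auto simp: S_def)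
      obtain t2 a2 where s2: "s2 = (t2, a2)" "t2 \<ge> 0" "a2 \<in> A" using s12 by (auto simp: S_def)
      \<comment> \<open>Convexity of \<open>A\<close>: the two rays combine into one through the
        weighted mean. If both weights vanish, any point of \<open>A\<close> serves.\<close>
      obtain a where a: "a \<in> A" "(t1 + t2) *\<^sub>R (a - p) = t1 *\<^sub>R (a1 - p) + t2 *\<^sub>R (a2 - p)"
      proof (cases "t1 + t2 = 0")
        case True
        then have "t1 = 0" "t2 = 0" using s1 s2 by auto
        then show ?thesis using s1 by (intro that[of a1]) auto
      next
        case False
        define a where "a = (t1 / (t1 + t2)) *\<^sub>R a1 + (t2 / (t1 + t2)) *\<^sub>R a2"
        have "a \<in> A"
          unfolding a_def using False s1 s2 A(1)
          by (intro convexD) (auto simp flip: add_divide_distrib)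
        moreover have "(t1 + t2) *\<^sub>R a = t1 *\<^sub>R a1 + t2 *\<^sub>R a2"
          unfolding a_def using False by (simp add: scaleR_add_right)
        then have "(t1 + t2) *\<^sub>R (a - p) = t1 *\<^sub>R (a1 - p) + t2 *\<^sub>R (a2 - p)"
          by (simp add: algebra_simps)
        ultimately show ?thesis by (rule that)
      qed
      have "q (v + w) \<le> h (v + w) (t1 + t2, a)"
        using a s1 s2 by (intro upper) (auto simp: S_def)
      also have "\<dots> \<le> h v s1 + h w s2"
      proof -
        have "(v + w) - (t1 + t2) *\<^sub>R (a - p) = (v - t1 *\<^sub>R (a1 - p)) + (w - t2 *\<^sub>R (a2 - p))"
          by (simp only: a(2)) simp
        then have "norm ((v + w) - (t1 + t2) *\<^sub>R (a - p)) \<le>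
            norm (v - t1 *\<^sub>R (a1 - p)) + norm (w - t2 *\<^sub>R (a2 - p))"
          by (simp only: norm_triangle_ineq)
        then show ?thesis
          unfolding h_def s1 s2 prod.case distrib_left by linarith
      qed
      finally show ?thesis by simp
    qed
    then have "q (v + w) - h v s1 \<le> q w" if "s1 \<in> S" for s1
      using that by (intro greatest) auto
    then have "q (v + w) - q w \<le> q v" by (intro greatest) (force simp: algebra_simps)
    then show "q (v + w) \<le> q v + q w" by simp
  next
    fix t :: real and v assume t: "t > 0"
    have "q (t *\<^sub>R v) / t \<le> q v"
    proof (rule greatest)
      fix s assume s: "s \<in> S"
      obtain u a where s: "s = (u, a)" "u \<ge> 0" "a \<in> A" using s by (auto simp: S_def)
      have "q (t *\<^sub>R v) \<le> h (t *\<^sub>R v) (t * u, a)"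
        using s t by (intro upper) (auto simp: S_def)
      also have "\<dots> = norm (t *\<^sub>R (v - u *\<^sub>R (a - p))) - r * (t * u)"
        by (simp add: h_def scaleR_diff_right)
      also have "\<dots> = t * h v s" using t by (simp add: h_def s right_diff_distrib)
      finally show "q (t *\<^sub>R v) / t \<le> h v s" using t by (simp add: field_simps)
    qed
    then show "q (t *\<^sub>R v) \<le> t * q v" using t by (simp add: field_simps)
  next
    show "q 0 = 0"
      using q_le_norm[of 0] lower[of _ 0] by (intro antisym greatest) auto
  qed
  then obtain f where f: "linear f" "\<And>v. f v \<le> q v"
    using sublinear_dominates_linear[OF B] by blast
  have le_norm: "\<bar>f v\<bar> \<le> norm v" for v
    using f(2)[of v] f(2)[of "- v"] q_le_norm[of v] q_le_norm[of "- v"] linear_neg[OF f(1), of v]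
    by simp
  then have "bounded_linear f"
    using f(1) by (intro bounded_linear.intro bounded_linear_axioms.intro exI[of _ 1]) auto
  then have app: "blinfun_apply (Blinfun f) = f" by (rule bounded_linear_Blinfun_apply)
  show thesis
  proof (rule that[of "Blinfun f"])
    show "norm (Blinfun f) \<le> 1" using le_norm by (intro norm_blinfun_bound) (auto simp: app)
  next
    fix a assume a: "a \<in> A"
    have "f (a - p) \<le> h (a - p) (1, a)"
      using f(2)[of "a - p"] upper[of "(1, a)" "a - p"] a by (simp add: S_def)
    then show "Blinfun f a \<le> Blinfun f p - infdist p A"
      by (simp add: app h_def r_def linear_diff[OF f(1)])
  qed
qed

section \<open>Support functions and Minkowski sums\<close>

lemma bdd_above_blinfun_image:
  fixes x :: "'a::real_normed_vector \<Rightarrow>\<^sub>L real"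
  assumes "bounded A"
  shows "bdd_above (blinfun_apply x ` A)"
  using bounded_linear_image[OF assms blinfun.bounded_linear_right[of x]]
  by (rule bounded_imp_bdd_above)

lemma support_fun_upper:
  fixes x :: "'a::real_normed_vector \<Rightarrow>\<^sub>L real"
  assumes "bounded A" "a \<in> A"
  shows "x a \<le> support_fun x A"
  unfolding support_fun_def using assms by (intro cSUP_upper bdd_above_blinfun_image)

lemma support_fun_least:
  fixes x :: "'a::real_normed_vector \<Rightarrow>\<^sub>L real"
  assumes "A \<noteq> {}" "\<And>a. a \<in> A \<Longrightarrow> x a \<le> c"
  shows "support_fun x A \<le> c"
  unfolding support_fun_def using assms by (intro cSUP_least)

lemma support_fun_scaleR_left:
  fixes x :: "'a::real_normed_vector \<Rightarrow>\<^sub>L real"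
  assumes "A \<noteq> {}" "bounded A" "0 \<le> t"
  shows "support_fun (t *\<^sub>R x) A = t * support_fun x A"
proof (cases "t = 0")
  case True
  then show ?thesis using assms by (simp add: support_fun_def)
next
  case False
  with assms(3) have t: "t > 0" by simp
  show ?thesis
  proof (rule antisym)
    show "support_fun (t *\<^sub>R x) A \<le> t * support_fun x A"
      using assms t by (intro support_fun_least)
        (auto simp: blinfun.scaleR_left intro!: support_fun_upper)
    have "support_fun x A \<le> support_fun (t *\<^sub>R x) A / t"
      using assms t support_fun_upper[OF assms(2), of _ "t *\<^sub>R x"]
      by (intro support_fun_least) (auto simp: blinfun.scaleR_left field_simps)
    then show "t * support_fun x A \<le> support_fun (t *\<^sub>R x) A" using t by (simp add: field_simps)
  qed
qed

lemma support_fun_scaleR: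
  fixes x :: "'a::real_normed_vector \<Rightarrow>\<^sub>L real"
  assumes "0 \<le> t"
  shows "support_fun x ((*\<^sub>R) t ` A) = support_fun (t *\<^sub>R x) A"
  by (simp add: support_fun_def image_image blinfun.scaleR_left blinfun.scaleR_right)

lemma support_fun_plus:
  fixes x :: "'a::real_normed_vector \<Rightarrow>\<^sub>L real"
  assumes "A \<noteq> {}" "bounded A" "B \<noteq> {}" "bounded B" "bounded (A + B)"
  shows "support_fun x (A + B) = support_fun x A + support_fun x B"
proof (rule antisym)
  show "support_fun x (A + B) \<le> support_fun x A + support_fun x B"
    using assms
    by (intro support_fun_least)
      (auto simp: set_plus_def blinfun.add_right intro!: add_mono support_fun_upper)
  have "support_fun x A \<le> support_fun x (A + B) - x b" if "b \<in> B" for b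
    using assms that support_fun_upper[OF assms(5), of _ x]
    by (intro support_fun_least) (auto simp: blinfun.add_right le_diff_eq simp flip: blinfun.add_right)
  then have "support_fun x B \<le> support_fun x (A + B) - support_fun x A"
    using assms by (intro support_fun_least) (auto simp: le_diff_eq add.commute)
  then show "support_fun x A + support_fun x B \<le> support_fun x (A + B)" by simp
qed

lemma bounded_set_plus:
  fixes A B :: "'a::real_normed_vector set"
  assumes "bounded A" "bounded B"
  shows "bounded (A + B)"
  using bounded_plus[OF assms] by (simp add: set_plus_image case_prod_beta image_def)

text \<open>The three claims are proved jointly because additivity for one more summand needs the
  partial sum to be nonempty and bounded. For an infinite index set both sums have the default value
  zero, which for sets is \<open>{0}\<close>.\<close>

lemma
  fixes A :: "'i \<Rightarrow> 'a::real_normed_vector set" and x :: "'a \<Rightarrow>\<^sub>L real"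
  assumes "\<And>i. i \<in> I \<Longrightarrow> A i \<noteq> {} \<and> bounded (A i)"
  shows Minkowski_sum_nonempty: "(\<Sum>i\<in>I. A i) \<noteq> {}"
    and Minkowski_sum_bounded: "bounded (\<Sum>i\<in>I. A i)"
    and support_fun_sum: "support_fun x (\<Sum>i\<in>I. A i) = (\<Sum>i\<in>I. support_fun x (A i))"
proof -
  have "(\<Sum>i\<in>I. A i) \<noteq> {} \<and> bounded (\<Sum>i\<in>I. A i) \<and>
      support_fun x (\<Sum>i\<in>I. A i) = (\<Sum>i\<in>I. support_fun x (A i))"
    using assms
  proof (induction I rule: infinite_finite_induct)
    case (insert i I)
    then have ne: "A i \<noteq> {}" "bounded (A i)" "(\<Sum>i\<in>I. A i) \<noteq> {}" "bounded (\<Sum>i\<in>I. A i)"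
      and IH: "support_fun x (\<Sum>i\<in>I. A i) = (\<Sum>i\<in>I. support_fun x (A i))" by auto
    have "A i + (\<Sum>i\<in>I. A i) \<noteq> {}" using ne(1,3) by (auto simp: set_plus_def)
    moreover have bounded: "bounded (A i + (\<Sum>i\<in>I. A i))" using ne by (intro bounded_set_plus)
    ultimately show ?case using insert.hyps support_fun_plus[OF ne bounded, of x] IH by simp
  qed (auto simp: support_fun_def)
  then show "(\<Sum>i\<in>I. A i) \<noteq> {}" "bounded (\<Sum>i\<in>I. A i)"
    "support_fun x (\<Sum>i\<in>I. A i) = (\<Sum>i\<in>I. support_fun x (A i))" by auto
qed

text \<open>This also applies to the Aumann integral, whose closedness is therefore never proved.\<close>
lemma hausdorff_dist_le_support_fun:
  fixes A C :: "'a::real_normed_vector set"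
  assumes B: "finite B" "span B = (UNIV :: 'a set)"
    and A: "A \<noteq> {}" "bounded A" "convex A" and C: "C \<noteq> {}" "bounded C" "convex C"
    and r: "\<And>x :: 'a \<Rightarrow>\<^sub>L real. norm x \<le> 1 \<Longrightarrow> \<bar>support_fun x A - support_fun x C\<bar> \<le> r"
  shows "hausdorff_dist A C \<le> r"
proof -
  have one_sided: "infdist d E \<le> r"
    if D: "d \<in> D" "bounded D" and E: "E \<noteq> {}" "convex E"
      and r: "\<And>x :: 'a \<Rightarrow>\<^sub>L real. norm x \<le> 1 \<Longrightarrow> \<bar>support_fun x D - support_fun x E\<bar> \<le> r"
    for d and D E :: "'a set"
  proof -
    obtain x :: "'a \<Rightarrow>\<^sub>L real"
      where x: "norm x \<le> 1" "\<And>e. e \<in> E \<Longrightarrow> x e \<le> x d - infdist d E"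
      using infdist_separation[OF B E(2,1)] by blast
    \<comment> \<open>The separating functional turns distance into a gap: the support function of
      \<open>D\<close> exceeds that of \<open>E\<close> by at least
      \<open>infdist d E\<close>.\<close>
    have "support_fun x E \<le> x d - infdist d E" using E x by (intro support_fun_least)
    moreover have "x d \<le> support_fun x D" using D by (intro support_fun_upper)
    ultimately show ?thesis using r[OF x(1)] by linarith
  qed
  have "infdist a C \<le> r" if "a \<in> A" for a using that A C r by (intro one_sided[of a A C])
  moreover have "infdist c A \<le> r" if "c \<in> C" for c
    using that A C r by (intro one_sided[of c C A]) (auto simp: abs_minus_commute)
  ultimately show ?thesis
    unfolding hausdorff_dist_infdist[OF A(1) C(1)] using A C by (auto intro!: cSUP_least)
qed

section \<open>Coordinates in a finite-dimensional normed space\<close>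

text \<open>Tychonoff. Coordinates outside \<open>B\<close> are pinned to 0, so that coefficient
  vectors indexed by \<open>B\<close> live in the full function type with its product
  topology.\<close>

lemma compact_coordinate_cube:
  fixes B :: "'b set"
  shows "compact (PiE UNIV (\<lambda>b. if b \<in> B then {-1..1} else {0}) :: ('b \<Rightarrow> real) set)"
proof -
  have "compactin (product_topology (\<lambda>_. euclidean) UNIV)
      (PiE UNIV (\<lambda>b. if b \<in> B then {-1..1} else {0}) :: ('b \<Rightarrow> real) set)"
    by (subst compactin_PiE) auto
  then show ?thesis by (simp add: euclidean_product_topology)
qed

text \<open>A norm minimum over the compact sphere \<open>\<Sum>\<bar>c b\<bar> = 1\<close> of coefficients.\<close>
lemma independent_coefficient_bound:
  fixes B :: "'a::real_normed_vector set"
  assumes B: "finite B" "independent B"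
  obtains C where "C > 0" "\<And>c. (\<Sum>b\<in>B. \<bar>c b\<bar>) \<le> C * norm (\<Sum>b\<in>B. c b *\<^sub>R b)"
proof (cases "B = {}")
  case True
  then show ?thesis by (intro that[of 1]) auto
next
  case False
  define S where "S = PiE UNIV (\<lambda>b. if b \<in> B then {-1..1::real} else {0}) \<inter> {c. (\<Sum>b\<in>B. \<bar>c b\<bar>) = 1}"
  have coord: "continuous_on UNIV (\<lambda>c :: 'a \<Rightarrow> real. c b)" for b
    by (rule continuous_on_product_coordinates)
  have "closed {c :: 'a \<Rightarrow> real. (\<Sum>b\<in>B. \<bar>c b\<bar>) = 1}"
    by (intro closed_Collect_eq continuous_intros coord)
  then have "compact S"
    unfolding S_def by (intro compact_Int_closed compact_coordinate_cube)
  moreover have "S \<noteq> {}"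
  proof -
    obtain b where b: "b \<in> B" using False by auto
    have "(\<Sum>a\<in>B. \<bar>if a = b then 1 else 0 :: real\<bar>) = (\<Sum>a\<in>B. if a = b then 1 else 0)"
      by (intro sum.cong) auto
    then have "(\<lambda>a. if a = b then 1 else 0) \<in> S"
      using b B(1) by (auto simp: S_def)
    then show ?thesis by blast
  qed
  moreover have "continuous_on S (\<lambda>c. norm (\<Sum>b\<in>B. c b *\<^sub>R b))"
    by (intro continuous_intros continuous_on_subset[OF coord]) auto
  ultimately obtain c0 where c0: "c0 \<in> S"
    and min: "\<And>c. c \<in> S \<Longrightarrow> norm (\<Sum>b\<in>B. c0 b *\<^sub>R b) \<le> norm (\<Sum>b\<in>B. c b *\<^sub>R b)"
    using continuous_attains_inf[of S "\<lambda>c. norm (\<Sum>b\<in>B. c b *\<^sub>R b)"] by blast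
  define \<delta> where "\<delta> = norm (\<Sum>b\<in>B. c0 b *\<^sub>R b)"
  have "\<delta> > 0"
  proof (rule ccontr)
    assume "\<not> \<delta> > 0"
    then have "(\<Sum>b\<in>B. c0 b *\<^sub>R b) = 0" by (simp add: \<delta>_def)
    then have "c0 b = 0" if "b \<in> B" for b using independentD[OF B(2,1)] that by blast
    then show False using c0 by (simp add: S_def)
  qed
  have "(\<Sum>b\<in>B. \<bar>c b\<bar>) \<le> inverse \<delta> * norm (\<Sum>b\<in>B. c b *\<^sub>R b)" for c
  proof (cases "(\<Sum>b\<in>B. \<bar>c b\<bar>) = 0")
    case True
    then show ?thesis using \<open>\<delta> > 0\<close> by simp
  next
    case False
    define t where "t = (\<Sum>b\<in>B. \<bar>c b\<bar>)"
    have t: "t > 0" using False by (simp add: t_def less_le sum_nonneg)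
    define d where "d b = (if b \<in> B then c b / t else 0)" for b
    have "\<bar>c b\<bar> \<le> t" if "b \<in> B" for b
      unfolding t_def using B(1) that by (intro member_le_sum) auto
    then have "- t \<le> c b" "c b \<le> t" if "b \<in> B" for b using that by (force simp: abs_le_iff)+
    moreover have "(\<Sum>b\<in>B. \<bar>d b\<bar>) = (\<Sum>b\<in>B. \<bar>c b\<bar>) / t"
      using t by (simp add: d_def sum_divide_distrib)
    ultimately have "d \<in> S" using t by (auto simp: S_def d_def PiE_iff t_def[symmetric] divide_simps)
    then have "\<delta> \<le> norm (\<Sum>b\<in>B. d b *\<^sub>R b)" unfolding \<delta>_def by (rule min)
    also have "(\<Sum>b\<in>B. d b *\<^sub>R b) = (1 / t) *\<^sub>R (\<Sum>b\<in>B. c b *\<^sub>R b)"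
      by (simp add: d_def scaleR_sum_right)
    finally have "\<delta> * t \<le> norm (\<Sum>b\<in>B. c b *\<^sub>R b)" using t by (simp add: field_simps)
    then show ?thesis using \<open>\<delta> > 0\<close> by (simp add: t_def field_simps)
  qed
  then show ?thesis using \<open>\<delta> > 0\<close> by (intro that[of "inverse \<delta>"]) auto
qed

text \<open>The point is continuity of the coordinates when only a norm is given; the coefficient
  bound for an independent set provides it.\<close>

lemma finite_dimensional_coordinates:
  assumes "\<exists>B :: 'a::real_normed_vector set. finite B \<and> span B = UNIV"
  obtains B :: "'a::real_normed_vector set" and \<phi> :: "'a \<Rightarrow> 'a::real_normed_vector \<Rightarrow>\<^sub>L real"
  where "finite B" "span B = UNIV" "\<And>a. (\<Sum>b\<in>B. \<phi> b a *\<^sub>R b) = a"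
proof -
  obtain B0 :: "'a set" where B0: "finite B0" "span B0 = UNIV" using assms by blast
  obtain B where B: "B \<subseteq> B0" "independent B" "span B = (UNIV :: 'a set)"
    using maximal_independent_subset[of B0] B0(2)
    by (metis span_superset span_minimal subspace_span top.extremum_uniqueI)
  have fin: "finite B" using B(1) B0(1) by (rule finite_subset)
  obtain C where C: "C > 0" "\<And>c. (\<Sum>b\<in>B. \<bar>c b\<bar>) \<le> C * norm (\<Sum>b\<in>B. c b *\<^sub>R b)"
    using independent_coefficient_bound[OF fin B(2)] by blast
  have rep: "(\<Sum>b\<in>B. representation B a b *\<^sub>R b) = a" for a
    using fin B by (intro sum_representation_eq) auto
  have "bounded_linear (\<lambda>a. representation B a b)" if b: "b \<in> B" for b
  proof (rule bounded_linear_intro)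
    show "representation B (v + w) b = representation B v b + representation B w b" for v w
      using B by (simp add: representation_add)
    show "representation B (r *\<^sub>R v) b = r *\<^sub>R representation B v b" for r v
      using B by (simp add: representation_scale)
    show "norm (representation B v b) \<le> norm v * C" for v
    proof -
      have "\<bar>representation B v b\<bar> \<le> (\<Sum>b\<in>B. \<bar>representation B v b\<bar>)"
        using b fin by (intro member_le_sum) auto
      with C(2)[of "representation B v"] show ?thesis by (simp add: rep mult.commute)
    qed
  qed
  then have "blinfun_apply (Blinfun (\<lambda>a. representation B a b)) a = representation B a b"
    if "b \<in> B" for a b using that by (simp add: bounded_linear_Blinfun_apply)
  then show thesis
    using fin B(3) rep by (intro that[of B "\<lambda>b. Blinfun (\<lambda>a. representation B a b)"]) auto
qed

text \<open>Pigeonhole: the values of a functional at the points of \<open>B\<close> are rounded to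
  a grid of width \<delta>, only finitely many grid cells meet the ball, and one functional is kept
  from each. Two functionals in one cell differ by at most \<delta> on \<open>B\<close>, hence by at
  most \<delta> times the sum of the norms of the coordinates.\<close>

lemma finite_net_of_dual_ball:
  fixes B :: "'a::real_normed_vector set" and \<phi> :: "'a \<Rightarrow> 'a \<Rightarrow>\<^sub>L real"
  assumes B: "finite B" and \<phi>: "\<And>a. (\<Sum>b\<in>B. \<phi> b a *\<^sub>R b) = a" and \<epsilon>: "\<epsilon> > 0"
  obtains N :: "('a \<Rightarrow>\<^sub>L real) set" where "finite N"
    "\<And>x. norm x \<le> 1 \<Longrightarrow> \<exists>y\<in>N. norm (x - y) \<le> \<epsilon>"
proof -
  \<comment> \<open>Adding 1 keeps \<open>R\<close> positive when \<open>B\<close> is empty.\<close>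
  define R where "R = (\<Sum>b\<in>B. norm (\<phi> b)) + 1"
  have R: "R > 0" unfolding R_def by (intro add_nonneg_pos sum_nonneg) auto
  define \<delta> where "\<delta> = \<epsilon> / R"
  have \<delta>: "\<delta> > 0" using R \<epsilon> by (simp add: \<delta>_def)
  define \<kappa> where "\<kappa> x = restrict (\<lambda>b. \<lfloor>blinfun_apply x b / \<delta>\<rfloor>) B" for x :: "'a \<Rightarrow>\<^sub>L real"
  define U where "U = {x :: 'a \<Rightarrow>\<^sub>L real. norm x \<le> 1}"
  have "\<kappa> ` U \<subseteq> PiE B (\<lambda>b. {\<lfloor>- norm b / \<delta>\<rfloor>..\<lfloor>norm b / \<delta>\<rfloor>})"
  proof (clarsimp simp: \<kappa>_def U_def)
    fix x :: "'a \<Rightarrow>\<^sub>L real" and b assume x: "norm x \<le> 1" and "b \<in> B"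
    have "\<bar>x b\<bar> \<le> norm x * norm b" using norm_blinfun[of x b] by simp
    also have "\<dots> \<le> norm b" using x by (simp add: mult_left_le_one_le)
    finally show "\<lfloor>- (norm b / \<delta>)\<rfloor> \<le> \<lfloor>x b / \<delta>\<rfloor> \<and> \<lfloor>x b / \<delta>\<rfloor> \<le> \<lfloor>norm b / \<delta>\<rfloor>"
      using \<delta> by (intro conjI floor_mono) (auto simp: divide_simps)
  qed
  moreover have "finite (PiE B (\<lambda>b. {\<lfloor>- norm b / \<delta>\<rfloor>..\<lfloor>norm b / \<delta>\<rfloor>}))"
    using B by (intro finite_PiE) auto
  ultimately have "finite (\<kappa> ` U)" by (rule finite_subset)
  then obtain N where N: "N \<subseteq> U" "finite N" "\<kappa> ` U = \<kappa> ` N"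
    using finite_subset_image[of "\<kappa> ` U" \<kappa> U] by auto
  have "\<exists>y\<in>N. norm (x - y) \<le> \<epsilon>" if "norm x \<le> 1" for x
  proof -
    have "\<kappa> x \<in> \<kappa> ` N" using that N(3) by (auto simp: U_def)
    then obtain y where y: "y \<in> N" "\<kappa> x = \<kappa> y" by auto
    have diff: "\<bar>x b - y b\<bar> \<le> \<delta>" if "b \<in> B" for b
    proof -
      have "\<lfloor>x b / \<delta>\<rfloor> = \<lfloor>y b / \<delta>\<rfloor>"
        using fun_cong[OF y(2), of b] that by (simp add: \<kappa>_def)
      then have "\<bar>x b / \<delta> - y b / \<delta>\<bar> \<le> 1" by linarith
      then show ?thesis using \<delta> by (simp add: field_simps abs_le_iff)
    qed
    have "norm (x - y) \<le> \<epsilon>"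
    proof (rule norm_blinfun_bound)
      fix a
      have "(x - y) a = (x - y) (\<Sum>b\<in>B. \<phi> b a *\<^sub>R b)" by (simp add: \<phi>)
      also have "\<dots> = (\<Sum>b\<in>B. \<phi> b a * (x b - y b))"
        by (simp add: blinfun.sum_right blinfun.scaleR_right blinfun.diff_left)
      finally have "\<bar>(x - y) a\<bar> \<le> (\<Sum>b\<in>B. \<bar>\<phi> b a\<bar> * \<bar>x b - y b\<bar>)"
        by (metis (no_types, lifting) abs_mult sum.cong sum_abs)
      also have "\<dots> \<le> (\<Sum>b\<in>B. (norm (\<phi> b) * norm a) * \<delta>)"
        using norm_blinfun[of "\<phi> _" a] diff by (intro sum_mono mult_mono) auto
      also have "\<dots> = (\<Sum>b\<in>B. norm (\<phi> b)) * (norm a * \<delta>)"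
        by (simp add: sum_distrib_right mult.assoc)
      also have "\<dots> \<le> R * (norm a * \<delta>)"
        using \<delta> by (intro mult_right_mono) (auto simp: R_def)
      also have "\<dots> = \<epsilon> * norm a" using R by (simp add: \<delta>_def)
      finally show "norm ((x - y) a) \<le> \<epsilon> * norm a" by simp
    qed (use \<epsilon> in simp)
    with y(1) show ?thesis by blast
  qed
  with N(2) show thesis by (rule that)
qed

section \<open>Measurable selections that maximise a functional\<close>

text \<open>Closed test sets rather than the open ones of \<open>set_valued_rv\<close>: an argmax
  set is examined through superlevel sets {h \<ge> r}, which are closed, and intersecting with them
  must stay within the test class.\<close>

definition closed_hit_measurable :: "'w measure \<Rightarrow> ('w \<Rightarrow> 'a::topological_space set) \<Rightarrow> bool" where
  "closed_hit_measurable M F \<longleftrightarrow> (\<forall>C. closed C \<longrightarrow> {\<omega>\<in>space M. F \<omega> \<inter> C \<noteq> {}} \<in> sets M)"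

text \<open>A compact value that meets every open neighbourhood of \<open>C\<close> meets
  \<open>C\<close> itself, because the distance to \<open>C\<close> attains its minimum on it. So
  countably many open tests decide a closed one.\<close>

lemma set_valued_rv_closed_hit_measurable:
  fixes F :: "'w \<Rightarrow> 'a::metric_space set"
  assumes F: "set_valued_rv M F" and comp: "\<And>\<omega>. \<omega> \<in> space M \<Longrightarrow> compact (F \<omega>)"
  shows "closed_hit_measurable M F"
  unfolding closed_hit_measurable_def
proof (intro allI impI)
  fix C :: "'a set" assume C: "closed C"
  show "{\<omega>\<in>space M. F \<omega> \<inter> C \<noteq> {}} \<in> sets M"
  \<comment> \<open>\<open>infdist a {}\<close> is 0 by default, so the neighbourhoods below would
    not shrink to the empty set.\<close>
  proof (cases "C = {}")
    case False
    let ?U = "\<lambda>n. {a. infdist a C < 1 / real (Suc n)}"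
    have iff: "F \<omega> \<inter> C \<noteq> {} \<longleftrightarrow> (\<forall>n. F \<omega> \<inter> ?U n \<noteq> {})" if \<omega>: "\<omega> \<in> space M" for \<omega>
    proof
      assume "F \<omega> \<inter> C \<noteq> {}"
      then obtain a where "a \<in> F \<omega>" "a \<in> C" by blast
      then show "\<forall>n. F \<omega> \<inter> ?U n \<noteq> {}" by (intro allI) (force simp: disjoint_iff)
    next
      assume hit: "\<forall>n. F \<omega> \<inter> ?U n \<noteq> {}"
      then have "F \<omega> \<noteq> {}" by blast
      moreover have "continuous_on (F \<omega>) (\<lambda>a. infdist a C)" by (intro continuous_intros)
      ultimately obtain a where a: "a \<in> F \<omega>" "\<And>b. b \<in> F \<omega> \<Longrightarrow> infdist a C \<le> infdist b C"
        using continuous_attains_inf[OF comp[OF \<omega>]] by blast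
      have "infdist a C \<le> 1 / real (Suc n)" for n
        using hit a(2) by (force simp: disjoint_iff dest: spec[of _ n])
      then have "infdist a C \<le> 0"
        using LIMSEQ_le_const[OF LIMSEQ_Suc[OF lim_1_over_n]] by (auto simp: add.commute)
      then have "infdist a C = 0" using infdist_nonneg[of a C] by linarith
      with C False have "a \<in> C" by (simp add: in_closed_iff_infdist_zero)
      with a(1) show "F \<omega> \<inter> C \<noteq> {}" by blast
    qed
    have eq: "{\<omega>\<in>space M. F \<omega> \<inter> C \<noteq> {}} = (\<Inter>n. {\<omega>\<in>space M. F \<omega> \<inter> ?U n \<noteq> {}})"
      by (rule set_eqI) (simp add: iff del: of_nat_Suc cong: conj_cong)
    have "open (?U n)" for n by (intro open_Collect_less continuous_intros)
    then have "{\<omega>\<in>space M. F \<omega> \<inter> ?U n \<noteq> {}} \<in> sets M" for n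
      using F by (simp add: set_valued_rv_def)
    then show ?thesis unfolding eq by (intro sets.countable_INT) auto
  qed simp
qed

definition argmax_on :: "('a \<Rightarrow> real) \<Rightarrow> 'a set \<Rightarrow> 'a set" where
  "argmax_on h A = {a\<in>A. \<forall>b\<in>A. h b \<le> h a}"

lemma
  fixes A :: "'a::metric_space set"
  assumes A: "compact A" "A \<noteq> {}" and h: "continuous_on UNIV h"
  shows argmax_on_nonempty: "argmax_on h A \<noteq> {}" and argmax_on_compact: "compact (argmax_on h A)"
proof -
  obtain m where m: "m \<in> A" "\<And>b. b \<in> A \<Longrightarrow> h b \<le> h m"
    using continuous_attains_sup[OF A continuous_on_subset[OF h subset_UNIV]] by blast
  then show "argmax_on h A \<noteq> {}" by (auto simp: argmax_on_def)
  have "argmax_on h A = A \<inter> {a. h m \<le> h a}"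
    using m by (auto simp: argmax_on_def intro: order_trans)
  moreover have "closed {a. h m \<le> h a}" using h by (intro closed_Collect_le continuous_intros)
  ultimately show "compact (argmax_on h A)" using A(1) by (simp add: compact_Int_closed)
qed

text \<open>A maximiser lies in \<open>C\<close> exactly when the part of the set inside
  \<open>C\<close> is nonempty and reaches every level that the whole set reaches. By compactness
  rational levels suffice, which leaves countably many closed tests.\<close>

lemma closed_hit_measurable_argmax_on:
  fixes F :: "'w \<Rightarrow> 'a::metric_space set"
  assumes F: "closed_hit_measurable M F" and comp: "\<And>\<omega>. \<omega> \<in> space M \<Longrightarrow> compact (F \<omega>)"
    and h: "continuous_on UNIV h"
  shows "closed_hit_measurable M (\<lambda>\<omega>. argmax_on h (F \<omega>))"
  unfolding closed_hit_measurable_def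
proof (intro allI impI)
  fix C :: "'a set" assume C: "closed C"
  let ?H = "\<lambda>r. {a. r \<le> h a}"
  have H: "closed (?H r)" for r using h by (intro closed_Collect_le continuous_intros)
  have iff: "argmax_on h (F \<omega>) \<inter> C \<noteq> {} \<longleftrightarrow>
      F \<omega> \<inter> C \<noteq> {} \<and> (\<forall>r\<in>\<rat>. F \<omega> \<inter> ?H r \<noteq> {} \<longrightarrow> F \<omega> \<inter> (C \<inter> ?H r) \<noteq> {})" (is "?L \<longleftrightarrow> ?R")
    if \<omega>: "\<omega> \<in> space M" for \<omega>
  proof
    assume ?L
    then obtain a where a: "a \<in> F \<omega>" "a \<in> C" "\<And>b. b \<in> F \<omega> \<Longrightarrow> h b \<le> h a"
      by (auto simp: argmax_on_def)
    then have "a \<in> F \<omega> \<inter> (C \<inter> ?H r)" if "b \<in> F \<omega> \<inter> ?H r" for b r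
      using that a(1,2) by (auto intro: order_trans[OF _ a(3)])
    then show ?R using a by blast
  next
    assume R: ?R
    have "compact (F \<omega> \<inter> C)" using comp[OF \<omega>] C by (rule compact_Int_closed)
    then obtain a where a: "a \<in> F \<omega> \<inter> C" "\<And>b. b \<in> F \<omega> \<inter> C \<Longrightarrow> h b \<le> h a"
      using continuous_attains_sup[OF _ conjunct1[OF R] continuous_on_subset[OF h subset_UNIV]]
      by blast
    have "h b \<le> h a" if b: "b \<in> F \<omega>" for b
    proof (rule ccontr)
      assume "\<not> h b \<le> h a"
      then obtain r where r: "r \<in> \<rat>" "h a < r" "r < h b" using Rats_dense_in_real[of "h a" "h b"] by auto
      then have "b \<in> F \<omega> \<inter> ?H r" using b by auto
      with R r(1) obtain c where "c \<in> F \<omega> \<inter> (C \<inter> ?H r)" by blast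
      with a(2)[of c] r(2) show False by auto
    qed
    with a(1) show ?L by (auto simp: argmax_on_def)
  qed
  have meas: "{\<omega>\<in>space M. F \<omega> \<inter> D \<noteq> {}} \<in> sets M" if "closed D" for D
    using F that by (simp add: closed_hit_measurable_def)
  have "{\<omega>\<in>space M. F \<omega> \<inter> C \<noteq> {} \<and>
      (\<forall>r\<in>\<rat>. F \<omega> \<inter> ?H r \<noteq> {} \<longrightarrow> F \<omega> \<inter> (C \<inter> ?H r) \<noteq> {})} \<in> sets M"
    by (intro sets.sets_Collect_conj sets.sets_Collect_countable_All' sets.sets_Collect_imp
        countable_rat meas H C closed_Int)
  then show "{\<omega>\<in>space M. argmax_on h (F \<omega>) \<inter> C \<noteq> {}} \<in> sets M"
    by (simp only: iff cong: conj_cong)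
qed

text \<open>A function is constant on its argmax set, and later reductions only shrink the set, so
  constancy is kept.\<close>

lemma measurable_subset_constant_on:
  fixes F :: "'w \<Rightarrow> 'a::metric_space set"
  assumes "finite H" "\<And>h. h \<in> H \<Longrightarrow> continuous_on UNIV (h :: 'a \<Rightarrow> real)"
    and "closed_hit_measurable M F"
    and "\<And>\<omega>. \<omega> \<in> space M \<Longrightarrow> compact (F \<omega>) \<and> F \<omega> \<noteq> {}"
  shows "\<exists>G. closed_hit_measurable M G \<and>
    (\<forall>\<omega>\<in>space M. compact (G \<omega>) \<and> G \<omega> \<noteq> {} \<and> G \<omega> \<subseteq> F \<omega> \<and>
      (\<forall>h\<in>H. \<forall>a\<in>G \<omega>. \<forall>b\<in>G \<omega>. h a = h b))"
  using assms
proof (induction H arbitrary: F)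
  case empty
  then show ?case by blast
next
  case (insert h H)
  let ?F = "\<lambda>\<omega>. argmax_on h (F \<omega>)"
  have h: "continuous_on UNIV h" using insert.prems by simp
  have F: "compact (F \<omega>)" "F \<omega> \<noteq> {}" if "\<omega> \<in> space M" for \<omega> using insert.prems(3) that by auto
  have "closed_hit_measurable M ?F"
    using insert.prems(2) F(1) h by (rule closed_hit_measurable_argmax_on)
  moreover have "compact (?F \<omega>) \<and> ?F \<omega> \<noteq> {}" if "\<omega> \<in> space M" for \<omega>
    using argmax_on_compact[OF F h] argmax_on_nonempty[OF F h] that by blast
  ultimately obtain G where G: "closed_hit_measurable M G"
    "\<And>\<omega>. \<omega> \<in> space M \<Longrightarrow> compact (G \<omega>) \<and> G \<omega> \<noteq> {} \<and> G \<omega> \<subseteq> ?F \<omega> \<and>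
      (\<forall>h\<in>H. \<forall>a\<in>G \<omega>. \<forall>b\<in>G \<omega>. h a = h b)"
    using insert.IH[of ?F] insert.prems(1) by auto
  show ?case
  proof (intro exI[of _ G] conjI ballI)
    fix \<omega> g a b
    assume \<omega>: "\<omega> \<in> space M" and "g \<in> insert h H" and ab: "a \<in> G \<omega>" "b \<in> G \<omega>"
    then consider "g = h" | "g \<in> H" by blast
    then show "g a = g b"
    proof cases
      case 1
      have "a \<in> ?F \<omega>" "b \<in> ?F \<omega>" using G(2)[OF \<omega>] ab by blast+
      then show ?thesis unfolding 1 by (intro antisym) (auto simp: argmax_on_def)
    qed (use G(2)[OF \<omega>] ab in blast)
  next
    fix \<omega> assume "\<omega> \<in> space M"
    from G(2)[OF this] show "compact (G \<omega>)" "G \<omega> \<noteq> {}" "G \<omega> \<subseteq> F \<omega>"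
      by (blast, blast, auto simp only: argmax_on_def)
  qed (rule G(1))
qed

text \<open>Maximise \<open>h\<close> first, then make the separating functions constant: what
  remains is a singleton. Preimages of open sets under its point are complements of closed hitting
  sets, hence measurable.\<close>

lemma measurable_maximising_selection:
  fixes F :: "'w \<Rightarrow> 'a::metric_space set" and h :: "'a \<Rightarrow> real"
  assumes F: "closed_hit_measurable M F"
      "\<And>\<omega>. \<omega> \<in> space M \<Longrightarrow> compact (F \<omega>) \<and> F \<omega> \<noteq> {}"
    and h: "continuous_on UNIV h"
    and H: "finite H" "\<And>g. g \<in> H \<Longrightarrow> continuous_on UNIV (g :: 'a \<Rightarrow> real)"
    and separating: "\<And>a b. (\<And>g. g \<in> H \<Longrightarrow> g a = g b) \<Longrightarrow> a = b"
  obtains f where "f \<in> borel_measurable M" "\<And>\<omega>. \<omega> \<in> space M \<Longrightarrow> f \<omega> \<in> F \<omega>"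
    "\<And>\<omega> a. \<omega> \<in> space M \<Longrightarrow> a \<in> F \<omega> \<Longrightarrow> h a \<le> h (f \<omega>)"
proof -
  let ?F = "\<lambda>\<omega>. argmax_on h (F \<omega>)"
  have "closed_hit_measurable M ?F"
    using F h by (intro closed_hit_measurable_argmax_on) auto
  moreover have "compact (?F \<omega>) \<and> ?F \<omega> \<noteq> {}" if "\<omega> \<in> space M" for \<omega>
    using argmax_on_compact[OF _ _ h] argmax_on_nonempty[OF _ _ h] F(2)[OF that] by blast
  ultimately have "\<exists>G. closed_hit_measurable M G \<and>
    (\<forall>\<omega>\<in>space M. compact (G \<omega>) \<and> G \<omega> \<noteq> {} \<and> G \<omega> \<subseteq> ?F \<omega> \<and>
      (\<forall>g\<in>H. \<forall>a\<in>G \<omega>. \<forall>b\<in>G \<omega>. g a = g b))"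
    by (intro measurable_subset_constant_on H)
  then obtain G where G: "closed_hit_measurable M G"
    and all: "\<forall>\<omega>\<in>space M. compact (G \<omega>) \<and> G \<omega> \<noteq> {} \<and> G \<omega> \<subseteq> ?F \<omega> \<and>
      (\<forall>g\<in>H. \<forall>a\<in>G \<omega>. \<forall>b\<in>G \<omega>. g a = g b)"
    by (elim exE conjE)
  have G': "G \<omega> \<noteq> {}" "G \<omega> \<subseteq> ?F \<omega>" "\<forall>g\<in>H. \<forall>a\<in>G \<omega>. \<forall>b\<in>G \<omega>. g a = g b"
    if "\<omega> \<in> space M" for \<omega>
    using bspec[OF all that] by simp_all
  define f where "f \<omega> = (SOME a. a \<in> G \<omega>)" for \<omega>
  have f: "f \<omega> \<in> G \<omega>" if "\<omega> \<in> space M" for \<omega>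
    unfolding f_def using G'(1)[OF that] by (simp add: some_in_eq)
  have single: "G \<omega> = {f \<omega>}" if "\<omega> \<in> space M" for \<omega>
  proof (intro equalityI subsetI)
    fix a assume "a \<in> G \<omega>"
    then have "a = f \<omega>" using f[OF that] G'(3)[OF that] by (intro separating) blast
    then show "a \<in> {f \<omega>}" by simp
  qed (simp add: f that)
  have "f \<in> borel_measurable M"
  proof (rule borel_measurableI)
    fix S :: "'a set" assume "open S"
    then have "{\<omega>\<in>space M. G \<omega> \<inter> (- S) \<noteq> {}} \<in> sets M"
      using G by (simp add: closed_hit_measurable_def closed_Compl)
    then have "space M - {\<omega>\<in>space M. G \<omega> \<inter> (- S) \<noteq> {}} \<in> sets M" by blast
    also have "space M - {\<omega>\<in>space M. G \<omega> \<inter> (- S) \<noteq> {}} = f -` S \<inter> space M" using single by auto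
    finally show "f -` S \<inter> space M \<in> sets M" .
  qed
  moreover have "f \<omega> \<in> argmax_on h (F \<omega>)" if "\<omega> \<in> space M" for \<omega> using f[OF that] G'(2)[OF that] by blast
  then have "f \<omega> \<in> F \<omega>" "\<And>a. a \<in> F \<omega> \<Longrightarrow> h a \<le> h (f \<omega>)" if "\<omega> \<in> space M" for \<omega>
    using that by (auto simp: argmax_on_def)
  ultimately show thesis by (rule that)
qed

section \<open>The Aumann integral in finite dimension\<close>

lemma Pkc_subset_Pk: "A \<in> Pkc \<Longrightarrow> A \<in> Pk"
  by (simp add: Pkc_def Pk_def)

lemma Pk_bounded: "A \<in> Pk \<Longrightarrow> bounded A"
  by (simp add: Pk_iff compact_imp_bounded)

lemma norm_le_set_norm:
  assumes "A \<in> Pk" "a \<in> A"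
  shows "norm a \<le> set_norm A"
  unfolding set_norm_eq_Sup_norm[OF assms(1)]
  using assms Pk_bounded by (intro cSUP_upper) (auto simp: bdd_above_norm)

lemma set_norm_nonneg:
  assumes "A \<in> Pk"
  shows "0 \<le> set_norm A"
proof -
  obtain a where "a \<in> A" using assms by (auto simp: Pk_iff)
  then show ?thesis using norm_le_set_norm[OF assms] norm_ge_zero order_trans by blast
qed

lemma abs_support_fun_le:
  fixes x :: "'a::real_normed_vector \<Rightarrow>\<^sub>L real"
  assumes "A \<noteq> {}" "\<And>a. a \<in> A \<Longrightarrow> norm a \<le> L"
  shows "\<bar>support_fun x A\<bar> \<le> norm x * L"
proof -
  have bound: "\<bar>x a\<bar> \<le> norm x * L" if "a \<in> A" for a
    using norm_blinfun[of x a] mult_left_mono[OF assms(2)[OF that], of "norm x"] by simp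
  have "bounded A" using assms(2) by (auto simp: bounded_iff)
  obtain a where a: "a \<in> A" using assms(1) by blast
  have "support_fun x A \<le> norm x * L"
    using bound by (intro support_fun_least assms(1)) (auto simp: abs_le_iff)
  moreover have "- (norm x * L) \<le> support_fun x A"
    using bound[OF a] support_fun_upper[OF \<open>bounded A\<close> a, of x] by linarith
  ultimately show ?thesis by (simp add: abs_le_iff)
qed

lemma support_fun_Lipschitz:
  fixes x y :: "'a::real_normed_vector \<Rightarrow>\<^sub>L real"
  assumes A: "A \<noteq> {}" "\<And>a. a \<in> A \<Longrightarrow> norm a \<le> L"
  shows "\<bar>support_fun x A - support_fun y A\<bar> \<le> norm (x - y) * L"
proof -
  have bdd: "bounded A" using A(2) by (auto simp: bounded_iff)
  have one_sided: "support_fun x A \<le> support_fun y A + norm (x - y) * L" for x y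
  proof (rule support_fun_least[OF A(1)])
    fix a assume a: "a \<in> A"
    have "x a - y a \<le> norm (x - y) * norm a"
      using norm_blinfun[of "x - y" a] by (simp add: blinfun.diff_left)
    also have "\<dots> \<le> norm (x - y) * L" using A(2)[OF a] by (simp add: mult_left_mono)
    finally show "x a \<le> support_fun y A + norm (x - y) * L"
      using support_fun_upper[OF bdd a, of y] by linarith
  qed
  show ?thesis
    using one_sided[of x y] one_sided[of y x] by (simp add: abs_le_iff norm_minus_commute)
qed

text \<open>The supremum exceeds r exactly when the random set hits the open set {g > r}.\<close>

lemma borel_measurable_SUP_set_valued:
  fixes g :: "'a::topological_space \<Rightarrow> real"
  assumes F: "set_valued_rv M F" and g: "continuous_on UNIV g"
    and bdd: "\<And>\<omega>. \<omega> \<in> space M \<Longrightarrow> bdd_above (g ` F \<omega>)"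
  shows "(\<lambda>\<omega>. SUP a\<in>F \<omega>. g a) \<in> borel_measurable M"
proof (rule borel_measurableI_greater)
  fix r :: real
  have "open {a. r < g a}" using g by (intro open_Collect_less continuous_intros)
  then have "{\<omega>\<in>space M. F \<omega> \<inter> {a. r < g a} \<noteq> {}} \<in> sets M"
    using F by (simp add: set_valued_rv_def)
  also have "{\<omega>\<in>space M. F \<omega> \<inter> {a. r < g a} \<noteq> {}} = {\<omega>\<in>space M. r < (SUP a\<in>F \<omega>. g a)}"
  proof (rule Collect_cong, rule conj_cong)
    fix \<omega> assume "\<omega> \<in> space M"
    then show "(F \<omega> \<inter> {a. r < g a} \<noteq> {}) \<longleftrightarrow> r < (SUP a\<in>F \<omega>. g a)"
      using F bdd by (subst less_cSUP_iff) (auto simp: set_valued_rv_def)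
  qed simp
  finally show "{\<omega>\<in>space M. r < (SUP a\<in>F \<omega>. g a)} \<in> sets M" .
qed

lemma borel_measurable_support_fun:
  fixes x :: "'a::real_normed_vector \<Rightarrow>\<^sub>L real"
  assumes "set_valued_rv M F" "\<And>\<omega>. \<omega> \<in> space M \<Longrightarrow> F \<omega> \<in> Pk"
  shows "(\<lambda>\<omega>. support_fun x (F \<omega>)) \<in> borel_measurable M"
  unfolding support_fun_def
  using assms Pk_bounded
  by (intro borel_measurable_SUP_set_valued bdd_above_blinfun_image continuous_intros) auto

lemma borel_measurable_set_norm:
  fixes F :: "'w \<Rightarrow> 'a::real_normed_vector set"
  assumes "set_valued_rv M F" "\<And>\<omega>. \<omega> \<in> space M \<Longrightarrow> F \<omega> \<in> Pk"
  shows "(\<lambda>\<omega>. set_norm (F \<omega>)) \<in> borel_measurable M"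
proof -
  have "(\<lambda>\<omega>. SUP a\<in>F \<omega>. norm a) \<in> borel_measurable M"
    using assms Pk_bounded
    by (intro borel_measurable_SUP_set_valued bdd_above_norm[THEN iffD2] continuous_intros) auto
  then show ?thesis
    using assms(2) set_norm_eq_Sup_norm by (subst measurable_cong) auto
qed

locale integrably_bounded_set_rv = prob_space M for M :: "'w measure" +
  fixes F :: "'w \<Rightarrow> 'a::{banach, second_countable_topology} set"
  assumes finite_dim: "\<exists>B :: 'a set. finite B \<and> span B = UNIV"
    and set_valued: "set_valued_rv M F"
    and values_Pkc: "\<And>\<omega>. \<omega> \<in> space M \<Longrightarrow> F \<omega> \<in> Pkc"
    and integrable_set_norm: "integrable M (\<lambda>\<omega>. set_norm (F \<omega>))"
begin

lemma values_Pk: "\<omega> \<in> space M \<Longrightarrow> F \<omega> \<in> Pk"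
  using values_Pkc Pkc_subset_Pk by blast

lemma integrable_support_fun: "integrable M (\<lambda>\<omega>. support_fun x (F \<omega>))"
proof (rule Bochner_Integration.integrable_bound)
  show "integrable M (\<lambda>\<omega>. norm x * set_norm (F \<omega>))" using integrable_set_norm by simp
  show "(\<lambda>\<omega>. support_fun x (F \<omega>)) \<in> borel_measurable M"
    using set_valued values_Pk by (rule borel_measurable_support_fun)
  show "AE \<omega> in M. norm (support_fun x (F \<omega>)) \<le> norm (norm x * set_norm (F \<omega>))"
  proof (rule AE_I2)
    fix \<omega> assume "\<omega> \<in> space M"
    then have F: "F \<omega> \<in> Pk" by (rule values_Pk)
    then show "norm (support_fun x (F \<omega>)) \<le> norm (norm x * set_norm (F \<omega>))"
      using abs_support_fun_le[of "F \<omega>" "set_norm (F \<omega>)" x] norm_le_set_norm[OF F]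
        set_norm_nonneg[OF F] by (simp add: Pk_iff)
  qed
qed

text \<open>The coordinates serve as the separating family, and \<open>set_norm\<close> is an
  integrable majorant of every selection.\<close>

lemma maximising_integrable_selection:
  fixes x :: "'a \<Rightarrow>\<^sub>L real"
  obtains f where "f \<in> integrable_selections M F"
    "\<And>\<omega>. \<omega> \<in> space M \<Longrightarrow> x (f \<omega>) = support_fun x (F \<omega>)"
proof -
  obtain B :: "'a set" and \<phi> :: "'a \<Rightarrow> 'a \<Rightarrow>\<^sub>L real"
    where B: "finite B" "span B = UNIV" and \<phi>: "\<And>a. (\<Sum>b\<in>B. \<phi> b a *\<^sub>R b) = a"
    by (rule finite_dimensional_coordinates[OF finite_dim]) (rule that)
  have comp: "compact (F \<omega>) \<and> F \<omega> \<noteq> {}" if "\<omega> \<in> space M" for \<omega>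
    using values_Pk[OF that] by (simp add: Pk_iff)
  have hit: "closed_hit_measurable M F"
    using set_valued comp by (intro set_valued_rv_closed_hit_measurable) auto
  have sep: "a = b" if "\<And>g. g \<in> (\<lambda>b. blinfun_apply (\<phi> b)) ` B \<Longrightarrow> g a = g b" for a b
  proof -
    have "(\<Sum>i\<in>B. \<phi> i a *\<^sub>R i) = (\<Sum>i\<in>B. \<phi> i b *\<^sub>R i)"
      using that by (intro sum.cong) auto
    then show ?thesis by (simp only: \<phi>)
  qed
  obtain f where f: "f \<in> borel_measurable M" "\<And>\<omega>. \<omega> \<in> space M \<Longrightarrow> f \<omega> \<in> F \<omega>"
    "\<And>\<omega> a. \<omega> \<in> space M \<Longrightarrow> a \<in> F \<omega> \<Longrightarrow> x a \<le> x (f \<omega>)"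
  proof (rule measurable_maximising_selection[OF hit comp, of "blinfun_apply x"
        "(\<lambda>b. blinfun_apply (\<phi> b)) ` B"])
    show "a = b" if "\<And>g. g \<in> (\<lambda>b. blinfun_apply (\<phi> b)) ` B \<Longrightarrow> g a = g b" for a b
      using that by (rule sep)
  qed (use B in \<open>auto intro: continuous_intros\<close>)
  have "integrable M f"
  proof (rule Bochner_Integration.integrable_bound[OF integrable_set_norm f(1)], rule AE_I2)
    fix \<omega> assume \<omega>: "\<omega> \<in> space M"
    then show "norm (f \<omega>) \<le> norm (set_norm (F \<omega>))"
      using norm_le_set_norm[OF values_Pk[OF \<omega>] f(2)[OF \<omega>]] by simp
  qed
  then have "f \<in> integrable_selections M F"
    using f(2) by (auto simp: integrable_selections_def)
  moreover have "x (f \<omega>) = support_fun x (F \<omega>)" if "\<omega> \<in> space M" for \<omega>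
    using f(2,3)[OF that] comp[OF that]
    by (intro antisym support_fun_upper support_fun_least) (auto simp: compact_imp_bounded)
  ultimately show thesis by (rule that)
qed

lemma aumann_integral_nonempty: "aumann_integral M F \<noteq> {}"
proof -
  obtain f where "f \<in> integrable_selections M F"
    using maximising_integrable_selection[of 0] by blast
  then show ?thesis by (auto simp: aumann_integral_def)
qed

lemma norm_aumann_integral_le:
  assumes "a \<in> aumann_integral M F"
  shows "norm a \<le> (\<integral>\<omega>. set_norm (F \<omega>) \<partial>M)"
proof -
  obtain f where f: "a = integral\<^sup>L M f" "integrable M f" "AE \<omega> in M. f \<omega> \<in> F \<omega>"
    using assms by (auto simp: aumann_integral_def integrable_selections_def)
  have "norm a \<le> (\<integral>\<omega>. norm (f \<omega>) \<partial>M)" unfolding f(1) by (rule integral_norm_bound)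
  also have "\<dots> \<le> (\<integral>\<omega>. set_norm (F \<omega>) \<partial>M)"
  proof (rule integral_mono_AE)
    show "AE \<omega> in M. norm (f \<omega>) \<le> set_norm (F \<omega>)"
      using f(3) AE_space by eventually_elim (rule norm_le_set_norm[OF values_Pk])
  qed (use f(2) integrable_set_norm in auto)
  finally show ?thesis .
qed

text \<open>Inherited pointwise from the values: a convex combination of selections is a
  selection.\<close>

lemma convex_aumann_integral: "convex (aumann_integral M F)"
proof (rule convexI)
  fix a b and u v :: real
  assume ab: "a \<in> aumann_integral M F" "b \<in> aumann_integral M F"
    and uv: "0 \<le> u" "0 \<le> v" "u + v = 1"
  obtain f where f: "a = integral\<^sup>L M f" "integrable M f" "AE \<omega> in M. f \<omega> \<in> F \<omega>"
    using ab(1) by (auto simp: aumann_integral_def integrable_selections_def)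
  obtain g where g: "b = integral\<^sup>L M g" "integrable M g" "AE \<omega> in M. g \<omega> \<in> F \<omega>"
    using ab(2) by (auto simp: aumann_integral_def integrable_selections_def)
  have "AE \<omega> in M. u *\<^sub>R f \<omega> + v *\<^sub>R g \<omega> \<in> F \<omega>"
    using f(3) g(3) AE_space
  proof eventually_elim
    case (elim \<omega>)
    then have "convex (F \<omega>)" using values_Pkc by (simp add: Pkc_def)
    then show ?case using elim(1,2) uv by (rule convexD)
  qed
  then have "(\<lambda>\<omega>. u *\<^sub>R f \<omega> + v *\<^sub>R g \<omega>) \<in> integrable_selections M F"
    using f(2) g(2) by (simp add: integrable_selections_def)
  moreover have "u *\<^sub>R a + v *\<^sub>R b = (\<integral>\<omega>. u *\<^sub>R f \<omega> + v *\<^sub>R g \<omega> \<partial>M)"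
    using f(1,2) g(1,2) by simp
  ultimately show "u *\<^sub>R a + v *\<^sub>R b \<in> aumann_integral M F"
    unfolding aumann_integral_def by blast
qed

lemma support_fun_aumann_integral:
  "support_fun x (aumann_integral M F) = (\<integral>\<omega>. support_fun x (F \<omega>) \<partial>M)"
proof (rule antisym)
  show "support_fun x (aumann_integral M F) \<le> (\<integral>\<omega>. support_fun x (F \<omega>) \<partial>M)"
  proof (rule support_fun_least[OF aumann_integral_nonempty])
    fix a assume "a \<in> aumann_integral M F"
    then obtain f where f: "a = integral\<^sup>L M f" "integrable M f" "AE \<omega> in M. f \<omega> \<in> F \<omega>"
      by (auto simp: aumann_integral_def integrable_selections_def)
    have "x a = (\<integral>\<omega>. x (f \<omega>) \<partial>M)"
      unfolding f(1) by (rule integral_bounded_linear[OF blinfun.bounded_linear_right f(2), symmetric])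
    also have "\<dots> \<le> (\<integral>\<omega>. support_fun x (F \<omega>) \<partial>M)"
    proof (rule integral_mono_AE)
      show "integrable M (\<lambda>\<omega>. x (f \<omega>))"
        by (rule integrable_bounded_linear[OF blinfun.bounded_linear_right f(2)])
      show "AE \<omega> in M. x (f \<omega>) \<le> support_fun x (F \<omega>)"
        using f(3) AE_space by eventually_elim (rule support_fun_upper[OF Pk_bounded[OF values_Pk]])
    qed (rule integrable_support_fun)
    finally show "x a \<le> (\<integral>\<omega>. support_fun x (F \<omega>) \<partial>M)" .
  qed
  obtain f where f: "f \<in> integrable_selections M F"
    "\<And>\<omega>. \<omega> \<in> space M \<Longrightarrow> x (f \<omega>) = support_fun x (F \<omega>)"
    using maximising_integrable_selection[of x] by blast
  have int: "integrable M f" using f(1) by (simp add: integrable_selections_def)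
  have "(\<integral>\<omega>. support_fun x (F \<omega>) \<partial>M) = (\<integral>\<omega>. x (f \<omega>) \<partial>M)"
    using f(2) by (intro Bochner_Integration.integral_cong) auto
  also have "\<dots> = x (integral\<^sup>L M f)"
    by (rule integral_bounded_linear[OF blinfun.bounded_linear_right int])
  also have "\<dots> \<le> support_fun x (aumann_integral M F)"
  proof (rule support_fun_upper)
    show "bounded (aumann_integral M F)" using norm_aumann_integral_le by (auto simp: bounded_iff)
    show "integral\<^sup>L M f \<in> aumann_integral M F" using f(1) by (auto simp: aumann_integral_def)
  qed
  finally show "(\<integral>\<omega>. support_fun x (F \<omega>) \<partial>M) \<le> support_fun x (aumann_integral M F)" .
qed

end

section \<open>Moment bounds from compact uniform integrability\<close>

lemma compactin_Pk_set_norm_bound: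
  fixes K :: "'a::real_normed_vector set set"
  assumes "compactin (Metric_space.mtopology Pk Pk_dist) K"
  obtains R where "0 \<le> R" "\<And>A. A \<in> K \<Longrightarrow> set_norm A \<le> R"
proof -
  interpret Metric_space "Pk :: 'a set set" Pk_dist by (rule Metric_space_Pk)
  obtain A0 r where K: "K \<subseteq> mcball A0 r"
    using compactin_imp_mbounded[OF assms] by (auto simp: mbounded_def)
  have zero: "{0} \<in> (Pk :: 'a set set)" by (simp add: Pk_def)
  \<comment> \<open>For empty \<open>K\<close> nothing is known about the centre and radius of the
    ball; the maximum makes the bound nonnegative all the same.\<close>
  have "set_norm A \<le> max 0 (set_norm A0 + r)" if "A \<in> K" for A
  proof -
    have A: "A0 \<in> Pk" "A \<in> Pk" "Pk_dist A0 A \<le> r" using K that by (auto simp: mcball_def)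
    then have "set_norm A \<le> set_norm A0 + r"
      using hausdorff_dist_triangle[OF zero A(1,2)] by (simp add: set_norm_def Pk_dist_def)
    then show ?thesis by simp
  qed
  then show thesis by (intro that[of "max 0 (set_norm A0 + r)"]) auto
qed

text \<open>The instance \<epsilon> = 1 is enough: on the compact family the norm is at most
  \<open>R\<close>, and off it the integral is below 1. The integral being a nonnegative one, its
  finiteness yields integrability as well.\<close>

lemma (in prob_space) compactly_uniformly_integrable_L1_bound:
  fixes V :: "nat \<Rightarrow> 'a \<Rightarrow> 'b::real_normed_vector set"
  assumes cui: "compactly_uniformly_integrable 1 M V"
    and V: "\<And>n. n \<ge> 1 \<Longrightarrow> set_valued_rv M (V n)"
      "\<And>n \<omega>. n \<ge> 1 \<Longrightarrow> \<omega> \<in> space M \<Longrightarrow> V n \<omega> \<in> Pk"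
  obtains C where "0 \<le> C" "\<And>n. n \<ge> 1 \<Longrightarrow> integrable M (\<lambda>\<omega>. set_norm (V n \<omega>))"
    "\<And>n. n \<ge> 1 \<Longrightarrow> (\<integral>\<omega>. set_norm (V n \<omega>) \<partial>M) \<le> C"
proof -
  obtain K where K: "compactin (Metric_space.mtopology Pk Pk_dist) K"
    and tail: "\<And>n. n \<ge> 1 \<Longrightarrow>
      (\<integral>\<^sup>+\<omega>. ennreal (set_norm (V n \<omega>) powr 1) * indicator {\<omega>. V n \<omega> \<notin> K} \<omega> \<partial>M) < ennreal 1"
    using cui unfolding compactly_uniformly_integrable_def by (meson zero_less_one)
  obtain R where R: "0 \<le> R" "\<And>A. A \<in> K \<Longrightarrow> set_norm A \<le> R"
    using compactin_Pk_set_norm_bound[OF K] by blast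
  have main: "(\<integral>\<^sup>+\<omega>. ennreal (set_norm (V n \<omega>)) \<partial>M) \<le> ennreal (R + 1)" if n: "n \<ge> 1" for n
  proof -
    have [measurable]: "(\<lambda>\<omega>. set_norm (V n \<omega>)) \<in> borel_measurable M"
      using V n by (intro borel_measurable_set_norm) auto
    \<comment> \<open>\<open>ennreal\<close> sends negative reals to 0, so the second summand is the
      positive part of the excess over \<open>R\<close>; it vanishes whenever the value lies in
      \<open>K\<close>.\<close>
    have "(\<integral>\<^sup>+\<omega>. ennreal (set_norm (V n \<omega>)) \<partial>M) \<le>
        (\<integral>\<^sup>+\<omega>. ennreal R + ennreal (set_norm (V n \<omega>) - R) \<partial>M)"
      using R(1) by (intro nn_integral_mono) (auto simp: ennreal_plus_if intro: ennreal_leI)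
    also have "\<dots> = ennreal R + (\<integral>\<^sup>+\<omega>. ennreal (set_norm (V n \<omega>) - R) \<partial>M)"
      by (subst nn_integral_add) (auto simp: emeasure_space_1)
    also have "(\<integral>\<^sup>+\<omega>. ennreal (set_norm (V n \<omega>) - R) \<partial>M) \<le>
        (\<integral>\<^sup>+\<omega>. ennreal (set_norm (V n \<omega>) powr 1) * indicator {\<omega>. V n \<omega> \<notin> K} \<omega> \<partial>M)"
    proof (rule nn_integral_mono)
      fix \<omega> assume "\<omega> \<in> space M"
      then have "0 \<le> set_norm (V n \<omega>)" using V(2)[OF n] by (intro set_norm_nonneg)
      then show "ennreal (set_norm (V n \<omega>) - R) \<le>
          ennreal (set_norm (V n \<omega>) powr 1) * indicator {\<omega>. V n \<omega> \<notin> K} \<omega>"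
        using R by (auto simp: indicator_def ennreal_neg intro: ennreal_leI)
    qed
    also have "\<dots> \<le> ennreal 1" using tail[OF n] by (rule less_imp_le)
    finally show ?thesis using R(1) by (simp add: add_left_mono)
  qed
  show thesis
  proof (rule that[of "R + 1"])
    fix n :: nat assume n: "n \<ge> 1"
    have meas: "(\<lambda>\<omega>. set_norm (V n \<omega>)) \<in> borel_measurable M"
      using V n by (intro borel_measurable_set_norm) auto
    have nonneg: "AE \<omega> in M. 0 \<le> set_norm (V n \<omega>)"
      using V(2)[OF n] by (intro AE_I2 set_norm_nonneg)
    have "(\<integral>\<^sup>+\<omega>. ennreal (set_norm (V n \<omega>)) \<partial>M) < \<infinity>"
      using main[OF n] by (simp add: le_less_trans)
    with meas nonneg show int: "integrable M (\<lambda>\<omega>. set_norm (V n \<omega>))"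
      by (intro integrableI_nonneg)
    show "(\<integral>\<omega>. set_norm (V n \<omega>) \<partial>M) \<le> R + 1"
      using main[OF n] R(1) nn_integral_eq_integral[OF int nonneg] by (simp del: ennreal_plus)
  qed (use R in simp)
qed

section \<open>Convergence in the Hausdorff metric\<close>

text \<open>For sets not known to be compact, such as averages of Aumann integrals.\<close>

lemma hausdorff_dist_nonneg_bounded:
  fixes A C :: "'a::real_normed_vector set"
  assumes "A \<noteq> {}" "bounded A" "C \<noteq> {}"
  shows "0 \<le> hausdorff_dist A C"
proof -
  obtain a where a: "a \<in> A" using assms(1) by blast
  have "0 \<le> infdist a C" by (rule infdist_nonneg)
  also have "\<dots> \<le> (SUP a\<in>A. infdist a C)"
    using a assms(2) by (intro cSUP_upper bdd_above_infdist)
  finally show ?thesis using assms by (simp add: hausdorff_dist_infdist le_max_iff_disj)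
qed

text \<open>Convergence of the support functions at the points \<open>\<plusminus>\<phi> b\<close> already bounds the sets \<open>A n\<close>,
  so that their support functions are equi-Lipschitz and finite nets suffice.\<close>
lemma hausdorff_dist_tendsto_0:
  fixes A D :: "nat \<Rightarrow> 'a::real_normed_vector set" and \<phi> :: "'a \<Rightarrow> 'a \<Rightarrow>\<^sub>L real"
  assumes B: "finite B" "span B = (UNIV :: 'a set)" and \<phi>: "\<And>a. (\<Sum>b\<in>B. \<phi> b a *\<^sub>R b) = a"
    and A: "\<And>n. n \<ge> 1 \<Longrightarrow> A n \<noteq> {} \<and> bounded (A n) \<and> convex (A n)"
    and D: "\<And>n. n \<ge> 1 \<Longrightarrow> D n \<noteq> {} \<and> convex (D n)"
    and D_le: "\<And>n d. n \<ge> 1 \<Longrightarrow> d \<in> D n \<Longrightarrow> norm d \<le> C"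
    and net: "\<And>\<epsilon>. \<epsilon> > 0 \<Longrightarrow> \<exists>N\<subseteq>Q. finite N \<and> (\<forall>x. norm x \<le> 1 \<longrightarrow> (\<exists>y\<in>N. norm (x - y) \<le> \<epsilon>))"
    and Q_\<phi>: "\<And>b. b \<in> B \<Longrightarrow> \<phi> b \<in> Q \<and> - \<phi> b \<in> Q"
    and conv: "\<And>x :: 'a \<Rightarrow>\<^sub>L real. x \<in> Q \<Longrightarrow>
      (\<lambda>n. support_fun x (A n) - support_fun x (D n)) \<longlonglongrightarrow> 0"
  shows "(\<lambda>n. hausdorff_dist (A n) (D n)) \<longlonglongrightarrow> 0"
proof -
  \<comment> \<open>On \<open>D n\<close> the support function at a signed coordinate is at most its
    norm times \<open>C\<close>; the extra 1 is the error once the difference of support functions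
    is below 1. Summing over coordinates bounds \<open>A n\<close>.\<close>
  define L where "L = (\<Sum>b\<in>B. (norm (\<phi> b) * C + 1) * norm b)"
  have D_bounded: "bounded (D n)" if "n \<ge> 1" for n using D_le[OF that] by (auto simp: bounded_iff)
  have close: "\<forall>\<^sub>F n in sequentially. \<forall>x\<in>N. \<bar>support_fun x (A n) - support_fun x (D n)\<bar> < e"
    if N: "finite N" "N \<subseteq> Q" and e: "e > 0" for N e
  proof (rule eventually_ball_finite[OF N(1)], rule ballI)
    fix x assume "x \<in> N"
    with N(2) conv have "(\<lambda>n. support_fun x (A n) - support_fun x (D n)) \<longlonglongrightarrow> 0" by blast
    from tendstoD[OF this e]
    show "\<forall>\<^sub>F n in sequentially. \<bar>support_fun x (A n) - support_fun x (D n)\<bar> < e"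
      by (simp add: dist_real_def)
  qed
  have "\<forall>\<^sub>F n in sequentially. \<forall>x\<in>\<phi> ` B \<union> (\<lambda>b. - \<phi> b) ` B.
      \<bar>support_fun x (A n) - support_fun x (D n)\<bar> < 1"
    using B(1) Q_\<phi> by (intro close) auto
  then have A_le: "\<forall>\<^sub>F n in sequentially. \<forall>a\<in>A n. norm a \<le> L"
    using eventually_ge_at_top[of 1]
  proof eventually_elim
    case (elim n)
    show ?case
    proof
      fix a assume a: "a \<in> A n"
      have upper: "x a \<le> norm x * C + 1" if "x \<in> \<phi> ` B \<union> (\<lambda>b. - \<phi> b) ` B" for x
      proof -
        have "x a \<le> support_fun x (A n)" using A[OF elim(2)] a by (intro support_fun_upper) auto
        moreover have "\<bar>support_fun x (D n)\<bar> \<le> norm x * C"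
          using D[OF elim(2)] D_le[OF elim(2)] by (intro abs_support_fun_le) auto
        ultimately show ?thesis using bspec[OF elim(1) that] by linarith
      qed
      have coord: "\<bar>\<phi> b a\<bar> \<le> norm (\<phi> b) * C + 1" if "b \<in> B" for b
        using upper[of "\<phi> b"] upper[of "- \<phi> b"] that
        by (simp add: blinfun.minus_left abs_le_iff)
      have "norm a = norm (\<Sum>b\<in>B. \<phi> b a *\<^sub>R b)" by (simp add: \<phi>)
      also have "\<dots> \<le> (\<Sum>b\<in>B. \<bar>\<phi> b a\<bar> * norm b)" by (rule sum_norm_le) simp
      also have "\<dots> \<le> L" unfolding L_def using coord by (intro sum_mono mult_right_mono) auto
      finally show "norm a \<le> L" .
    qed
  qed
  show ?thesis
  proof (rule tendstoI)
    fix \<epsilon> :: real assume \<epsilon>: "\<epsilon> > 0"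
    define R where "R = \<bar>L\<bar> + \<bar>C\<bar> + 1"
    \<comment> \<open>The error splits into three quarters of \<epsilon>: moving to a net point in
      \<open>A n\<close>, the difference there, and moving back in \<open>D n\<close>.
      \<open>R\<close> bounds both sets; the remaining quarter makes the final inequality
      strict.\<close>
    define \<delta> where "\<delta> = \<epsilon> / (4 * R)"
    have R: "R > 0" by (simp add: R_def add_nonneg_pos)
    have \<delta>: "\<delta> > 0" "\<delta> * R = \<epsilon> / 4" using \<epsilon> R by (simp_all add: \<delta>_def)
    obtain N where N: "N \<subseteq> Q" "finite N" "\<And>x. norm x \<le> 1 \<Longrightarrow> \<exists>y\<in>N. norm (x - y) \<le> \<delta>"
      using net[OF \<delta>(1)] by blast
    have "\<forall>\<^sub>F n in sequentially. \<forall>x\<in>N. \<bar>support_fun x (A n) - support_fun x (D n)\<bar> < \<epsilon> / 4"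
      using N \<epsilon> by (intro close) auto
    then show "\<forall>\<^sub>F n in sequentially. dist (hausdorff_dist (A n) (D n)) 0 < \<epsilon>"
      using A_le eventually_ge_at_top[of 1]
    proof eventually_elim
      case (elim n)
      have "hausdorff_dist (A n) (D n) \<le> 3 * (\<epsilon> / 4)"
      proof (rule hausdorff_dist_le_support_fun[OF B])
        fix x :: "'a \<Rightarrow>\<^sub>L real" assume "norm x \<le> 1"
        then obtain y where y: "y \<in> N" "norm (x - y) \<le> \<delta>" using N(3) by blast
        have lip: "\<bar>support_fun x E - support_fun y E\<bar> \<le> \<epsilon> / 4"
          if E: "E \<noteq> {}" "\<And>a. a \<in> E \<Longrightarrow> norm a \<le> R" for E
        proof -
          have "\<bar>support_fun x E - support_fun y E\<bar> \<le> norm (x - y) * R"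
            using E by (rule support_fun_Lipschitz)
          also have "\<dots> \<le> \<delta> * R" using y(2) R by (intro mult_right_mono) auto
          finally show ?thesis by (simp add: \<delta>(2))
        qed
        have "\<bar>support_fun x (A n) - support_fun y (A n)\<bar> \<le> \<epsilon> / 4"
          using A[OF elim(3)] elim(2) by (intro lip) (auto simp: R_def)
        moreover have "\<bar>support_fun x (D n) - support_fun y (D n)\<bar> \<le> \<epsilon> / 4"
        proof (rule lip)
          fix d assume "d \<in> D n"
          then have "norm d \<le> C" by (rule D_le[OF elim(3)])
          then show "norm d \<le> R" unfolding R_def by linarith
        qed (use D[OF elim(3)] in blast)
        ultimately show "\<bar>support_fun x (A n) - support_fun x (D n)\<bar> \<le> 3 * (\<epsilon> / 4)"
          using bspec[OF elim(1) y(1)] by linarith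
      qed (use A[OF elim(3)] D[OF elim(3)] D_bounded[OF elim(3)] in auto)
      moreover have "0 \<le> hausdorff_dist (A n) (D n)"
        using A[OF elim(3)] D[OF elim(3)] by (intro hausdorff_dist_nonneg_bounded) auto
      ultimately show ?case using \<epsilon> by simp
    qed
  qed
qed

lemma norm_Minkowski_sum_le:
  fixes A :: "'i \<Rightarrow> 'a::real_normed_vector set"
  assumes "finite I" "\<And>i a. i \<in> I \<Longrightarrow> a \<in> A i \<Longrightarrow> norm a \<le> C" "a \<in> (\<Sum>i\<in>I. A i)"
  shows "norm a \<le> real (card I) * C"
proof -
  obtain s where s: "a = sum s I" "\<And>i. i \<in> I \<Longrightarrow> s i \<in> A i"
    using assms(3) by (auto simp: set_sum_alt[OF assms(1)])
  have "norm a \<le> (\<Sum>i\<in>I. C)"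
    unfolding s(1) using assms(2) s(2) by (intro sum_norm_le) auto
  then show ?thesis by simp
qed

section \<open>The scalar law for uncorrelated variables and the final assembly\<close>

lemma (in prob_space) strong_law_uncorrelated:
  fixes \<xi> :: "nat \<Rightarrow> 'a \<Rightarrow> real"
  assumes int: "\<And>n. n \<ge> 1 \<Longrightarrow> integrable M (\<xi> n)"
    and unc: "\<And>m n. m \<ge> 1 \<Longrightarrow> n \<ge> 1 \<Longrightarrow> m \<noteq> n \<Longrightarrow> uncorrelated M (\<xi> m) (\<xi> n)"
    and var: "(\<Sum>n. nn_variance M (\<xi> (Suc n)) / ennreal ((real (Suc n))\<^sup>2)
               * ennreal ((ln (real (Suc n)))\<^sup>2)) < \<infinity>"
  shows "AE \<omega> in M. (\<lambda>n. (\<Sum>k=1..n. \<xi> k \<omega> - expectation (\<xi> k)) / real n) \<longlonglongrightarrow> 0"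
proof -
  \<comment> \<open>Index 0 is unconstrained, so it is filled with zero: the locale wants
    measurability at every index.\<close>
  define X where "X k \<omega> = (if k \<ge> 1 then \<xi> k \<omega> - expectation (\<xi> k) else 0)" for k \<omega>
  have meas: "X k \<in> borel_measurable M" for k
    unfolding X_def using int[of k] by (cases "k \<ge> 1") auto
  have X: "X k = (\<lambda>\<omega>. \<xi> k \<omega> - expectation (\<xi> k))" if "k \<ge> 1" for k
    using that by (auto simp: X_def)
  have var_eq: "nn_variance M (\<xi> k) = (\<integral>\<^sup>+\<omega>. ennreal ((X k \<omega>)\<^sup>2) \<partial>M)" if "k \<ge> 1" for k
    unfolding nn_variance_def X[OF that] ..
  let ?t = "\<lambda>n. nn_variance M (\<xi> (Suc n)) / ennreal ((real (Suc n))\<^sup>2)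
               * ennreal ((ln (real (Suc n)))\<^sup>2)"
  have sq_int: "integrable M (\<lambda>\<omega>. (X k \<omega>)\<^sup>2)" if k: "k \<ge> 2" for k
  proof -
    obtain m where m: "k = Suc m" "m \<ge> 1" using k by (cases k) auto
    \<comment> \<open>Needed to read off a finite variance: with weight 0 an infinite variance would
      go unnoticed, as infinity times 0 is 0 in \<open>ennreal\<close>.\<close>
    have "ln (real k) > 0" using k by simp
    have "?t m < \<infinity>"
      using var sum_le_suminf[of ?t "{m}"] by (simp add: le_less_trans)
    then have "nn_variance M (\<xi> k) < \<infinity>"
      using \<open>ln (real k) > 0\<close> m
      by (auto simp: ennreal_mult_less_top ennreal_divide_eq_top_iff less_top[symmetric]
          ennreal_mult_eq_top_iff top_unique)
    then show ?thesis
      using k meas by (intro integrableI_nonneg) (auto simp: var_eq)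
  qed
  interpret orthogonal_sequence M X
  proof
    fix j k :: nat assume "j \<ge> 2" "k \<ge> 2" "j \<noteq> k"
    then show "(\<integral>\<omega>. X j \<omega> * X k \<omega> \<partial>M) = 0"
      using unc[of j k] by (simp add: X uncorrelated_def covariance_def)
  qed (use meas sq_int in auto)
  have var2: "nn_variance M (\<xi> k) = ennreal (second_moment k)" if "k \<ge> 2" for k
    using that sq_int[OF that] by (simp add: var_eq second_moment_def nn_integral_eq_integral)
  have "?t n = ennreal (second_moment (Suc n) * (ln (real (Suc n)))\<^sup>2 / (real (Suc n))\<^sup>2)" for n
  \<comment> \<open>At n = 0 the weight is ln 1 = 0, so both sides vanish even for an infinite
    variance.\<close>
  proof (cases "n = 0")
    case False
    then have "nn_variance M (\<xi> (Suc n)) = ennreal (second_moment (Suc n))" by (intro var2) simp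
    then show ?thesis
      by (simp add: divide_ennreal second_moment_nonneg ennreal_mult'' [symmetric] del: of_nat_Suc)
  qed simp
  then have "(\<Sum>n. ennreal (second_moment (Suc n) * (ln (real (Suc n)))\<^sup>2 / (real (Suc n))\<^sup>2)) \<noteq> \<top>"
    using var by (simp add: less_top del: of_nat_Suc)
  then have "summable (\<lambda>n. second_moment (Suc n) * (ln (real (Suc n)))\<^sup>2 / (real (Suc n))\<^sup>2)"
    by (intro summable_suminf_not_top) (auto simp: second_moment_nonneg)
  then have "summable (\<lambda>k. second_moment k * (ln (real k))\<^sup>2 / (real k)\<^sup>2)"
    by (subst (asm) summable_Suc_iff)
  from strong_law[OF this] show ?thesis
  proof eventually_elim
    case (elim \<omega>)
    \<comment> \<open>The first variable, left out of the orthogonal sequence, is put back: a single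
      term divided by n is negligible.\<close>
    have "(\<lambda>n. X 1 \<omega> / real n) \<longlonglongrightarrow> 0" by (rule lim_const_over_n)
    with elim have "(\<lambda>n. X 1 \<omega> / real n + (\<Sum>k=2..n. X k \<omega>) / real n) \<longlonglongrightarrow> 0 + 0"
      by (intro tendsto_add)
    then have lim: "(\<lambda>n. X 1 \<omega> / real n + (\<Sum>k=2..n. X k \<omega>) / real n) \<longlonglongrightarrow> 0" by simp
    have "\<forall>\<^sub>F n in sequentially. X 1 \<omega> / real n + (\<Sum>k=2..n. X k \<omega>) / real n =
        (\<Sum>k=1..n. \<xi> k \<omega> - expectation (\<xi> k)) / real n"
      using eventually_ge_at_top[of 1]
    proof eventually_elim
      case (elim n)
      have "(\<Sum>k=1..n. \<xi> k \<omega> - expectation (\<xi> k)) = (\<Sum>k=1..n. X k \<omega>)"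
        by (intro sum.cong) (auto simp: X_def)
      also have "\<dots> = X 1 \<omega> + (\<Sum>k=2..n. X k \<omega>)"
        using elim by (simp add: sum.atLeast_Suc_atMost numeral_2_eq_2)
      finally show ?case by (simp add: add_divide_distrib)
    qed
    with lim show ?case by (rule Lim_transform_eventually)
  qed
qed

theorem theorem4p6:
  fixes M :: "'w measure"
    and V :: "nat \<Rightarrow> 'w \<Rightarrow> 'a::{banach, second_countable_topology} set"
  assumes "prob_space M" and "complete_measure M" and "nonatomic M"
    and "\<exists>B :: 'a set. finite B \<and> span B = UNIV"
    and "\<And>n. n \<ge> 1 \<Longrightarrow> set_valued_rv M (V n)"
    and "\<And>n \<omega>. n \<ge> 1 \<Longrightarrow> \<omega> \<in> space M \<Longrightarrow> V n \<omega> \<in> Pkc"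
    and "set_uncorrelated M V"
    and "compactly_uniformly_integrable 1 M V"
    and "\<And>x :: 'a \<Rightarrow>\<^sub>L real. norm x = 1 \<Longrightarrow>
           (\<Sum>n. nn_variance M (\<lambda>\<omega>. support_fun x (V (Suc n) \<omega>)) / ennreal ((real (Suc n))\<^sup>2)
                  * ennreal ((ln (real (Suc n)))\<^sup>2)) < \<infinity>"
  shows "AE \<omega> in M.
           (\<lambda>n. hausdorff_dist ((*\<^sub>R) (1 / real n) ` (\<Sum>k=1..n. V k \<omega>))
                               ((*\<^sub>R) (1 / real n) ` (\<Sum>k=1..n. aumann_integral M (V k))))
             \<longlonglongrightarrow> 0"
proof -
  interpret prob_space M by fact
  obtain B :: "'a set" and \<phi> :: "'a \<Rightarrow> 'a \<Rightarrow>\<^sub>L real"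
    where B: "finite B" "span B = UNIV" and \<phi>: "\<And>a. (\<Sum>b\<in>B. \<phi> b a *\<^sub>R b) = a"
    by (rule finite_dimensional_coordinates[OF assms(4)]) (rule that)
  have Pk: "V n \<omega> \<in> Pk" if "n \<ge> 1" "\<omega> \<in> space M" for n \<omega>
    using assms(6)[OF that] by (rule Pkc_subset_Pk)
  obtain C where C: "\<And>n. n \<ge> 1 \<Longrightarrow> integrable M (\<lambda>\<omega>. set_norm (V n \<omega>))"
    "\<And>n. n \<ge> 1 \<Longrightarrow> (\<integral>\<omega>. set_norm (V n \<omega>) \<partial>M) \<le> C"
    using compactly_uniformly_integrable_L1_bound[OF assms(8,5) Pk] by blast
  have rv: "integrably_bounded_set_rv M (V n)" if "n \<ge> 1" for n
    using assms(4-6) C(1) that by unfold_locales auto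
  define EV where "EV k = aumann_integral M (V k)" for k
  have EV: "EV k \<noteq> {}" "convex (EV k)" "\<And>a. a \<in> EV k \<Longrightarrow> norm a \<le> C"
    "\<And>x. support_fun x (EV k) = expectation (\<lambda>\<omega>. support_fun x (V k \<omega>))" if k: "k \<ge> 1" for k
  proof -
    interpret integrably_bounded_set_rv M "V k" using k by (rule rv)
    show "EV k \<noteq> {}" unfolding EV_def by (rule aumann_integral_nonempty)
    show "convex (EV k)" unfolding EV_def by (rule convex_aumann_integral)
    show "norm a \<le> C" if "a \<in> EV k" for a
      using norm_aumann_integral_le[of a] C(2)[OF k] that by (simp add: EV_def)
    show "support_fun x (EV k) = expectation (\<lambda>\<omega>. support_fun x (V k \<omega>))" for x
      unfolding EV_def by (rule support_fun_aumann_integral)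
  qed
  have EV_bounded: "bounded (EV k)" if "k \<ge> 1" for k using EV(3)[OF that] by (auto simp: bounded_iff)
  define A where "A n \<omega> = (*\<^sub>R) (1 / real n) ` (\<Sum>k=1..n. V k \<omega>)" for n \<omega>
  define D where "D n = (*\<^sub>R) (1 / real n) ` (\<Sum>k=1..n. EV k)" for n
  \<comment> \<open>Holds for n = 0 too: \<open>1 / real 0\<close> is 0 and both sides
    vanish.\<close>
  have support_average: "support_fun x ((*\<^sub>R) (1 / real n) ` (\<Sum>k=1..n. E k)) =
      (\<Sum>k=1..n. support_fun x (E k)) / real n"
    if "\<And>k. k \<ge> 1 \<Longrightarrow> E k \<noteq> {} \<and> bounded (E k)" for x :: "'a \<Rightarrow>\<^sub>L real" and E n
  proof -
    have E: "k \<in> {1..n} \<Longrightarrow> E k \<noteq> {} \<and> bounded (E k)" for k using that by simp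
    show ?thesis
      using support_fun_scaleR_left[OF Minkowski_sum_nonempty[of "{1..n}" E, OF E]
          Minkowski_sum_bounded[of "{1..n}" E, OF E], of "1 / real n" x]
        support_fun_sum[of "{1..n}" E x, OF E]
      by (simp add: support_fun_scaleR)
  qed
  have D: "D n \<noteq> {}" "convex (D n)" "\<And>d. d \<in> D n \<Longrightarrow> norm d \<le> C" if n: "n \<ge> 1" for n
  proof -
    show "D n \<noteq> {}"
      unfolding D_def using EV(1) EV_bounded Minkowski_sum_nonempty[of "{1..n}" EV] by auto
    show "convex (D n)" unfolding D_def using EV(2) by (intro convex_scaling convex_set_sum) auto
    fix d assume "d \<in> D n"
    then obtain a where a: "a \<in> (\<Sum>k=1..n. EV k)" "d = (1 / real n) *\<^sub>R a" by (auto simp: D_def)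
    have "norm a \<le> real (card {1..n}) * C"
      using EV(3) by (intro norm_Minkowski_sum_le[OF _ _ a(1)]) auto
    then show "norm d \<le> C" using n by (simp add: a(2) field_simps)
  qed
  have unit: "AE \<omega> in M. (\<lambda>n. support_fun x (A n \<omega>) - support_fun x (D n)) \<longlonglongrightarrow> 0"
    if x: "norm x = 1" for x
  proof -
    have "AE \<omega> in M. (\<lambda>n. (\<Sum>k=1..n. support_fun x (V k \<omega>) -
        expectation (\<lambda>\<omega>. support_fun x (V k \<omega>))) / real n) \<longlonglongrightarrow> 0"
    proof (rule strong_law_uncorrelated)
      show "integrable M (\<lambda>\<omega>. support_fun x (V n \<omega>))" if "n \<ge> 1" for n
        by (rule integrably_bounded_set_rv.integrable_support_fun[OF rv[OF that]])
      show "uncorrelated M (\<lambda>\<omega>. support_fun x (V m \<omega>)) (\<lambda>\<omega>. support_fun x (V n \<omega>))"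
        if "m \<ge> 1" "n \<ge> 1" "m \<noteq> n" for m n
        using assms(7) that by (simp add: set_uncorrelated_def)
    qed (rule assms(9)[OF x])
    then show ?thesis
      using AE_space
    proof eventually_elim
      case (elim \<omega>)
      have "support_fun x (A n \<omega>) - support_fun x (D n) =
          (\<Sum>k=1..n. support_fun x (V k \<omega>) - expectation (\<lambda>\<omega>. support_fun x (V k \<omega>))) / real n" for n
      proof -
        have "support_fun x (A n \<omega>) = (\<Sum>k=1..n. support_fun x (V k \<omega>)) / real n"
          unfolding A_def using Pk[OF _ elim(2)] Pk_bounded
          by (intro support_average) (auto simp: Pk_iff)
        moreover have "support_fun x (D n) = (\<Sum>k=1..n. support_fun x (EV k)) / real n"
          unfolding D_def using EV(1) EV_bounded by (intro support_average) auto
        ultimately show ?thesis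
          by (simp add: EV(4) sum_subtractf diff_divide_distrib)
      qed
      with elim(1) show ?case by simp
    qed
  qed
  have A: "A n \<omega> \<noteq> {} \<and> bounded (A n \<omega>) \<and> convex (A n \<omega>)" if n: "n \<ge> 1" "\<omega> \<in> space M" for n \<omega>
  proof -
    have V: "V k \<omega> \<noteq> {} \<and> bounded (V k \<omega>)" "convex (V k \<omega>)" if "k \<in> {1..n}" for k
      using assms(6)[of k \<omega>] n that by (auto simp: Pkc_def compact_imp_bounded)
    show ?thesis
      unfolding A_def
      using Minkowski_sum_nonempty[of "{1..n}" "\<lambda>k. V k \<omega>", OF V(1)]
        Minkowski_sum_bounded[of "{1..n}" "\<lambda>k. V k \<omega>", OF V(1)] V(2)
      by (auto intro!: bounded_scaling convex_scaling convex_set_sum)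
  qed
  \<comment> \<open>The hypothesis speaks of unit functionals, while net points and coordinates have
    arbitrary norm; positive homogeneity bridges the gap.\<close>
  have all: "AE \<omega> in M. (\<lambda>n. support_fun x (A n \<omega>) - support_fun x (D n)) \<longlonglongrightarrow> 0" for x
  proof (cases "x = 0")
    case True
    have "\<forall>\<^sub>F n in sequentially. support_fun 0 (A n \<omega>) - support_fun 0 (D n) = 0"
      if "\<omega> \<in> space M" for \<omega>
      using eventually_ge_at_top[of 1]
      by eventually_elim (use A that D in \<open>auto simp: support_fun_def\<close>)
    then show ?thesis unfolding True by (intro AE_I2 tendsto_eventually)
  next
    case False
    define u where "u = (1 / norm x) *\<^sub>R x"
    have u: "norm u = 1" "x = norm x *\<^sub>R u" using False by (simp_all add: u_def)
    from unit[OF u(1)] show ?thesis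
      using AE_space
    proof eventually_elim
      case (elim \<omega>)
      have "(\<lambda>n. norm x * (support_fun u (A n \<omega>) - support_fun u (D n))) \<longlonglongrightarrow> norm x * 0"
        by (intro tendsto_mult_left elim(1))
      then have lim: "(\<lambda>n. norm x * (support_fun u (A n \<omega>) - support_fun u (D n))) \<longlonglongrightarrow> 0" by simp
      have "\<forall>\<^sub>F n in sequentially. norm x * (support_fun u (A n \<omega>) - support_fun u (D n)) =
          support_fun x (A n \<omega>) - support_fun x (D n)"
        using eventually_ge_at_top[of 1]
      proof eventually_elim
        case (elim n)
        have "bounded (D n)" using D(3)[OF elim] by (auto simp: bounded_iff)
        then show ?case
          using A[OF elim \<open>\<omega> \<in> space M\<close>] D(1)[OF elim]
            support_fun_scaleR_left[of "A n \<omega>" "norm x" u] support_fun_scaleR_left[of "D n" "norm x" u]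
          by (simp add: u(2)[symmetric] right_diff_distrib)
      qed
      with lim show ?case by (rule Lim_transform_eventually)
    qed
  qed
  have "\<exists>N. finite N \<and> (\<forall>x :: 'a \<Rightarrow>\<^sub>L real. norm x \<le> 1 \<longrightarrow> (\<exists>y\<in>N. norm (x - y) \<le> 1 / real (Suc m)))" for m
    by (rule finite_net_of_dual_ball[OF B(1) \<phi>, of "1 / real (Suc m)"]) (simp, blast)
  then obtain N where N: "\<And>m. finite (N m)"
    "\<And>m x :: 'a \<Rightarrow>\<^sub>L real. norm x \<le> 1 \<Longrightarrow> \<exists>y\<in>N m. norm (x - y) \<le> 1 / real (Suc m)"
    by metis
  \<comment> \<open>Countable, so the exceptional null sets unite to one. The nets give uniformity,
    the signed coordinates give boundedness of the averages.\<close>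
  define Q where "Q = (\<Union>m. N m) \<union> \<phi> ` B \<union> (\<lambda>b. - \<phi> b) ` B"
  have "countable Q" using N(1) B(1) by (auto simp: Q_def intro: countable_finite)
  then have "AE \<omega> in M. \<forall>x\<in>Q. (\<lambda>n. support_fun x (A n \<omega>) - support_fun x (D n)) \<longlonglongrightarrow> 0"
    using all by (simp add: AE_ball_countable)
  then have "AE \<omega> in M. (\<lambda>n. hausdorff_dist (A n \<omega>) (D n)) \<longlonglongrightarrow> 0"
    using AE_space
  proof eventually_elim
    case (elim \<omega>)
    show ?case
    proof (rule hausdorff_dist_tendsto_0[OF B \<phi>, where Q = Q])
      fix \<epsilon> :: real assume "\<epsilon> > 0"
      then obtain m where "1 / real (Suc m) < \<epsilon>" using reals_Archimedean[of \<epsilon>] by (auto simp: inverse_eq_divide)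
      then have "\<exists>y\<in>N m. norm (x - y) \<le> \<epsilon>" if "norm x \<le> 1" for x
        using N(2)[OF that, of m] by (meson less_imp_le order_trans)
      moreover have "N m \<subseteq> Q" by (auto simp: Q_def)
      ultimately show "\<exists>N\<subseteq>Q. finite N \<and> (\<forall>x. norm x \<le> 1 \<longrightarrow> (\<exists>y\<in>N. norm (x - y) \<le> \<epsilon>))"
        using N(1) by blast
    qed (use A[OF _ elim(2)] D elim(1) in \<open>auto simp: Q_def\<close>)
  qed
  then show ?thesis unfolding A_def D_def EV_def .
qed

end
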